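(* Let $\lambda=(\lambda_1\ge\dots\ge\lambda_n\ge0)$ be a partition and let $\sigma_\lambda$ be the grassmannian permutation of shape $\lambda$ with a unique descent at position $n$. Write $X_n=(x_1,\dots,x_n)$. Then (A) $$\mathfrak{G}^{(\beta)}_{\sigma_\lambda}(X_n)=\det\bigl|h^{(\beta)}_{\lambda_j+i,\,j}(X_n)\bigr|_{1\le i,j\le n}=\frac{\det\bigl|x_i^{\lambda_j+n-j}(1+\beta x_i)^{j-1}\bigr|_{1\le i,j\le n}}{\prod_{1\le i<j\le n}(x_i-x_j)},$$ where for integers $m$, $k\ge1$ and a set of variables $X$ $$h^{(\beta)}_{m,k}(X)=\sum_{a=0}^{k-1}\binom{k-1}{a}h_{m-k+a}(X)\beta^a,$$ and $h_r(X)$ is the complete homogeneous symmetric polynomial of degree $r$ ($h_r=0$ for $r<0$). (B) $$\mathfrak{G}^{(\beta)}_{\sigma_\lambda}(X,Y)=\frac{\det\Bigl|\prod_{a=1}^{\lambda_j+n-j}(x_i+y_a+\beta x_iy_a)\,(1+\beta x_i)^{j-1}\Bigr|_{1\le i,j\le n}}{\prod_{1\le i<j\le n}(x_i-x_j)}.$$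
   Context: The grassmannian permutation $\sigma_\lambda\in\mathbb{S}_N$ ($N$ large) is given by $\sigma_\lambda(i)=i+\lambda_{n+1-i}$ for $1\le i\le n$ and $\sigma_\lambda(n+1)<\sigma_\lambda(n+2)<\cdots$. Let $\beta$ be an indeterminate. $\mathrm{IdC}_N(\beta)$ is the associative $\mathbb{Z}[\beta]$-algebra with generators $e_1,\dots,e_{N-1}$ and relations $e_ie_j=e_je_i$ if $|i-j|\ge2$, $e_ie_je_i=e_je_ie_j$ if $|i-j|=1$, $e_i^2=\beta e_i$. For $w\in\mathbb{S}_N$ put $e_w=e_{i_1}\cdots e_{i_\ell}$ for any reduced word $w=s_{i_1}\cdots s_{i_\ell}$ ($s_i=(i,i+1)$, permutations composed from right to left); the $e_w$ form a $\mathbb{Z}[\beta]$-basis. With commuting variables $x_i,y_i$ commuting with all $e_j$, put $h_i(x)=1+xe_i$, $x\oplus y=x+y+\beta xy$, $A_i(x)=h_{N-1}(x)\cdots h_i(x)$. The $\beta$-Grothendieck polynomials are defined by $A_1(x_1)\cdots A_{N-1}(x_{N-1})=\sum_{w\in\mathbb{S}_N}\mathfrak{G}_w^{(\beta)}(X)e_w$, and the double $\beta$-Grothendieck polynomials by $$\prod_{i=1,2,\dots,N-1}\ \prod_{j=N-i,\dots,1}h_{i+j-1}(x_i\oplus y_j)=\sum_{w\in\mathbb{S}_N}\mathfrak{G}_w^{(\beta)}(X,Y)e_w$$ (factors left to right in the indicated order). They are stable under $\mathbb{S}_N\subset\mathbb{S}_{N+1}$. *)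

theory Defs
  imports
    "HOL-Library.Poly_Mapping"
    "HOL-Combinatorics.Permutations"
    "HOL-Algebra.QuotRing"
    "HOL-Computational_Algebra.Polynomial_Factorial"
    "Jordan_Normal_Form.Determinant"
begin

section \<open>The coefficient ring\<close>

text \<open>
  The coefficient ring is \<open>\<int>[\<beta>][x\<^sub>1, x\<^sub>2, \<dots>, y\<^sub>1, y\<^sub>2, \<dots>]\<close>: finitely supported maps from monomials
  (exponent vectors) to \<open>\<int>[\<beta>]\<close>, with \<open>\<int>[\<beta>]\<close> given by the type \<^typ>\<open>int poly\<close>. The linear order on
  the variables has no mathematical role; the class \<open>idom\<close>, hence the fraction field, depends on it.
\<close>

datatype var = XVar nat | YVar nat

instantiation var :: linorder
begin

definition less_eq_var :: "var \<Rightarrow> var \<Rightarrow> bool" where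
  "u \<le> v \<longleftrightarrow> (case (u, v) of
      (XVar i, XVar j) \<Rightarrow> i \<le> j
    | (XVar i, YVar j) \<Rightarrow> True
    | (YVar i, XVar j) \<Rightarrow> False
    | (YVar i, YVar j) \<Rightarrow> i \<le> j)"

definition less_var :: "var \<Rightarrow> var \<Rightarrow> bool" where
  "u < v \<longleftrightarrow> u \<le> v \<and> \<not> v \<le> (u :: var)"

instance
  by standard (auto simp: less_eq_var_def less_var_def split: var.splits)

end

type_synonym coeff_ring = "(var \<Rightarrow>\<^sub>0 nat) \<Rightarrow>\<^sub>0 int poly"

definition bet :: coeff_ring where
  "bet = Poly_Mapping.single 0 [:0, 1:]"

definition xv :: "nat \<Rightarrow> coeff_ring" where
  "xv i = Poly_Mapping.single (Poly_Mapping.single (XVar i) 1) 1"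

definition yv :: "nat \<Rightarrow> coeff_ring" where
  "yv i = Poly_Mapping.single (Poly_Mapping.single (YVar i) 1) 1"


section \<open>The algebra with the variables adjoined\<close>

text \<open>
  Words in the generators, as an additively written monoid under concatenation, so that the
  convolution product on finitely supported maps makes \<open>word_monoid \<Rightarrow>\<^sub>0 coeff_ring\<close> the free
  associative algebra. Scalars, in particular the \<open>x\<^sub>i\<close> and \<open>y\<^sub>i\<close>, are central in it.
\<close>

datatype word_monoid = Word (letters: "nat list")

instantiation word_monoid :: monoid_add
begin

definition zero_word_monoid :: word_monoid where
  "0 = Word []"

definition plus_word_monoid :: "word_monoid \<Rightarrow> word_monoid \<Rightarrow> word_monoid" where
  "u + v = Word (letters u @ letters v)"

instance
  by standard (auto simp: zero_word_monoid_def plus_word_monoid_def)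

end

type_synonym free_algebra = "word_monoid \<Rightarrow>\<^sub>0 coeff_ring"

definition scal :: "coeff_ring \<Rightarrow> free_algebra" where
  "scal c = Poly_Mapping.single 0 c"

definition wd :: "nat list \<Rightarrow> free_algebra" where
  "wd ks = Poly_Mapping.single (Word ks) 1"

definition gen :: "nat \<Rightarrow> free_algebra" where
  "gen i = wd [i]"

text \<open>The free algebra on the generators \<open>e\<^sub>1, \<dots>, e\<^bsub>N-1\<^esub>\<close> only.\<close>

definition free_alg :: "nat \<Rightarrow> free_algebra ring" where
  "free_alg N = \<lparr>carrier = {f. \<forall>u \<in> Poly_Mapping.keys f. set (letters u) \<subseteq> {1..<N}},
                 monoid.mult = (*), one = 1, zero = 0, add = (+)\<rparr>"

definition idc_relators :: "nat \<Rightarrow> free_algebra set" where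
  "idc_relators N =
     {gen i * gen j - gen j * gen i | i j.
        i \<in> {1..<N} \<and> j \<in> {1..<N} \<and> \<bar>int i - int j\<bar> \<ge> 2}
   \<union> {gen i * gen j * gen i - gen j * gen i * gen j | i j.
        i \<in> {1..<N} \<and> j \<in> {1..<N} \<and> \<bar>int i - int j\<bar> = 1}
   \<union> {gen i * gen i - scal bet * gen i | i. i \<in> {1..<N}}"

definition idc_ideal :: "nat \<Rightarrow> free_algebra set" where
  "idc_ideal N = Idl\<^bsub>free_alg N\<^esub> (idc_relators N)"

text \<open>The algebra \<open>IdC\<^sub>N(\<beta>)\<close>, scalars extended from \<open>\<int>[\<beta>]\<close> to \<^typ>\<open>coeff_ring\<close>.\<close>

definition IdC :: "nat \<Rightarrow> free_algebra set ring" where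
  "IdC N = free_alg N Quot idc_ideal N"

definition idc_class :: "nat \<Rightarrow> free_algebra \<Rightarrow> free_algebra set" where
  "idc_class N f = idc_ideal N +>\<^bsub>free_alg N\<^esub> f"


section \<open>The elements indexed by permutations\<close>

text \<open>The symmetric group \<open>S\<^sub>N\<close> consists of the \<open>w :: nat \<Rightarrow> nat\<close> with \<open>w permutes {1..N}\<close>.\<close>

definition word_perm :: "nat list \<Rightarrow> nat \<Rightarrow> nat" where
  "word_perm ks = foldr (\<lambda>i w. transpose i (i + 1) \<circ> w) ks id"

definition reduced_word :: "nat \<Rightarrow> (nat \<Rightarrow> nat) \<Rightarrow> nat list \<Rightarrow> bool" where
  "reduced_word N w ks \<longleftrightarrow>
     is_arg_min length (\<lambda>ks. set ks \<subseteq> {1..<N} \<and> word_perm ks = w) ks"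

text \<open>
  A representative of \<open>e\<^sub>w\<close> in the free algebra. Its class in \<^term>\<open>IdC N\<close> does not depend on the
  reduced word chosen.
\<close>

definition e_perm :: "nat \<Rightarrow> (nat \<Rightarrow> nat) \<Rightarrow> free_algebra" where
  "e_perm N w = wd (SOME ks. reduced_word N w ks)"

text \<open>
  The coefficient at \<open>e\<^sub>w\<close> of the expansion of an element of \<^term>\<open>IdC N\<close>. The description is
  definite because the \<open>e\<^sub>w\<close> form a basis.
\<close>

definition idc_coeff :: "nat \<Rightarrow> free_algebra set \<Rightarrow> (nat \<Rightarrow> nat) \<Rightarrow> coeff_ring" where
  "idc_coeff N a =
     (THE c. (\<forall>w. \<not> w permutes {1..N} \<longrightarrow> c w = 0) \<and>
             a = idc_class N (\<Sum>w | w permutes {1..N}. scal (c w) * e_perm N w))"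


section \<open>Grothendieck polynomials\<close>

definition hfac :: "nat \<Rightarrow> coeff_ring \<Rightarrow> free_algebra" where
  "hfac i c = 1 + scal c * gen i"

definition bplus :: "coeff_ring \<Rightarrow> coeff_ring \<Rightarrow> coeff_ring" where
  "bplus a b = a + b + bet * a * b"

definition Afac :: "nat \<Rightarrow> nat \<Rightarrow> coeff_ring \<Rightarrow> free_algebra" where
  "Afac N i c = prod_list (map (\<lambda>k. hfac k c) (rev [i..<N]))"

definition groth :: "nat \<Rightarrow> (nat \<Rightarrow> nat) \<Rightarrow> coeff_ring" where
  "groth N w = idc_coeff N
     (idc_class N (prod_list (map (\<lambda>i. Afac N i (xv i)) [1..<N]))) w"

definition double_groth :: "nat \<Rightarrow> (nat \<Rightarrow> nat) \<Rightarrow> coeff_ring" where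
  "double_groth N w = idc_coeff N
     (idc_class N
       (prod_list (map (\<lambda>i.
          prod_list (map (\<lambda>j. hfac (i + j - 1) (bplus (xv i) (yv j))) (rev [1..<N - i + 1])))
        [1..<N]))) w"

definition grassmannian_perm :: "nat \<Rightarrow> nat \<Rightarrow> (nat \<Rightarrow> nat) \<Rightarrow> nat \<Rightarrow> nat" where
  "grassmannian_perm N n lam =
     (THE s. s permutes {1..N} \<and> (\<forall>i \<in> {1..n}. s i = i + lam (n + 1 - i)) \<and>
             strict_mono_on {n<..} s)"


section \<open>Complete homogeneous symmetric polynomials\<close>

text \<open>Sum of \<open>x\<^bsub>i(1)\<^esub> \<cdots> x\<^bsub>i(r)\<^esub>\<close> over \<open>1 \<le> i(1) \<le> \<dots> \<le> i(r) \<le> n\<close>.\<close>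

definition hsym :: "nat \<Rightarrow> int \<Rightarrow> coeff_ring" where
  "hsym n r = (if r < 0 then 0
     else (\<Sum>ks | length ks = nat r \<and> sorted ks \<and> set ks \<subseteq> {1..n}. prod_list (map xv ks)))"

definition hbeta :: "nat \<Rightarrow> int \<Rightarrow> nat \<Rightarrow> coeff_ring" where
  "hbeta n m k = (\<Sum>a = 0..k - 1. of_nat ((k - 1) choose a) * hsym n (m - int k + int a) * bet ^ a)"

end

theory Submission
  imports Defs "HOL-Computational_Algebra.Formal_Power_Series"
begin

text \<open>
  The coefficient of \<open>e\<^sub>w\<close> is read off from the representation of \<^term>\<open>IdC N\<close> on the free module with
  basis the permutations, where \<open>e\<^sub>i\<close> sends \<open>w\<close> to \<open>s\<^sub>i w\<close> if the length increases, and to \<open>\<beta> w\<close>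
  otherwise: it is the coefficient at \<open>w\<close> of the image of the identity (\<open>idc_coeff_eq_rep\<close>). That the \<open>e\<^sub>w\<close>
  span follows from normal forms of words, and that they are independent from the representation itself.

  A grassmannian permutation is a configuration of \<open>n\<close> particles on the sites \<open>1, \<dots>, N\<close>. The coefficients at
  grassmannian permutations transform among themselves: in \<open>h\<^sub>k(c) = 1 + c e\<^sub>k\<close>, a particle at \<open>k\<close> with
  \<open>k+1\<close> empty stays or moves on with weight \<open>c\<close>, a particle at \<open>k+1\<close> with \<open>k\<close> empty gets the weight
  \<open>1 + \<beta> c\<close>, and all other configurations are unchanged. The rows \<open>m > n\<close> of the generating product do not
  move anything, and row \<open>m \<le> n\<close> introduces the variable \<open>x\<^sub>m\<close> and releases particle \<open>m\<close>.

  It remains to see that the quotient of determinants obeys the same recursion. Applied to a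
  determinant, the sum over the moves of one row can be carried out in each column separately, because,
  the new configuration being given, the old positions of the particles range over disjoint intervals
  independently: from the new position of the left neighbour, exclusive, to the particle's own. The column
  sums telescope, and column operations identify the result with the determinant that has one row and one
  column more (\<open>branch_sum_closed\<close>, \<open>branching_det\<close>). In \<open>partial_row\<close> this is done one factor \<open>h\<^sub>k\<close> at a
  time, which changes one column at a time. The result, \<open>grassmannian_transfer\<close>, holds for all values of
  the variables with \<open>1 + \<beta> x\<^sub>i \<noteq> 0\<close>; \<open>y = 0\<close> gives the single polynomials. Their expression by the \<open>h\<^sup>(\<^sup>\<beta>\<^sup>)\<close> follows by factoring
  the matrix of the bialternant (\<open>jacobi_trudi_hbeta\<close>).
\<close>

section \<open>Determinants of factorial powers\<close>

text \<open>
  The multiplicative formal group law \<open>x \<oplus> y = x + y + b x y\<close>, over any commutative ring so that the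
  value \<open>b = 0\<close> is available too.
\<close>

definition fgl :: "'a::comm_ring_1 \<Rightarrow> 'a \<Rightarrow> 'a \<Rightarrow> 'a" where
  "fgl b x y = x + y + b * x * y"

text \<open>
  The factorial power \<open>(z \<oplus> y\<^sub>1) \<cdots> (z \<oplus> y\<^sub>k)\<close>.
\<close>

definition fpow :: "'a::comm_ring_1 \<Rightarrow> (nat \<Rightarrow> 'a) \<Rightarrow> 'a \<Rightarrow> nat \<Rightarrow> 'a" where
  "fpow b y z k = (\<Prod>a = 1..k. fgl b z (y a))"

lemma fpow_0 [simp]: "fpow b y z 0 = 1"
  by (simp add: fpow_def)

lemma fpow_Suc: "fpow b y z (Suc k) = fpow b y z k * fgl b z (y (Suc k))"
  by (simp add: fpow_def)

text \<open>
  With \<open>r\<^sub>p = x \<oplus> y\<^sub>p\<close>, and for \<open>a < k\<close>, this is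
  \<open>r\<^bsub>a+2\<^esub> \<cdots> r\<^sub>k \<cdot> fpow a + \<Sum> (1 + b r\<^bsub>p+1\<^esub>) r\<^bsub>p+2\<^esub> \<cdots> r\<^sub>k \<cdot> fpow p\<close>, the sum over \<open>a < p < k\<close> and all
  factorial powers taken at \<open>z\<close>. It collects the ways in which a particle of the system below can
  reach its position in one row, starting to the right of the new position of its left neighbour. The
  recursion on \<open>k\<close> is the effect of one more elementary move.
\<close>

fun branch_sum ::
  "'a::comm_ring_1 \<Rightarrow> (nat \<Rightarrow> 'a) \<Rightarrow> 'a \<Rightarrow> 'a \<Rightarrow> nat \<Rightarrow> nat \<Rightarrow> 'a" where
  "branch_sum b y x z a 0 = 0"
| "branch_sum b y x z a (Suc k) =
     (if k \<le> a then fpow b y z a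
      else fgl b x (y (Suc k)) * branch_sum b y x z a k
           + (1 + b * fgl b x (y (Suc k))) * fpow b y z k)"

lemma fgl_exchange: "(1 + b * z) * fgl b x y - (1 + b * x) * fgl b z y = x - z"
  by (simp add: fgl_def algebra_simps)

lemma fgl_cross:
  "(1 + b * fgl b x y) * (x - z) - (1 + b * x) * fgl b x y = - ((1 + b * x) * fgl b z y)"
  by (simp add: fgl_def algebra_simps)

text \<open>
  The sum telescopes after multiplication by \<open>x - z\<close>, because \<open>1 + b r\<^sub>p = (1 + b x)(1 + b y\<^sub>p)\<close> and
  \<open>(x \<oplus> y) - (z \<oplus> y) = (x - z)(1 + b y)\<close>.
\<close>

lemma branch_sum_closed:
  assumes "a < k"
  shows "(x - z) * branch_sum b y x z a k
    = (1 + b * z) * (\<Prod>i = Suc a..k. fgl b x (y i)) * fpow b y z a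
      - (1 + b * x) * fpow b y z k"
  using assms
proof (induction k)
  case (Suc k)
  let ?r = "fgl b x (y (Suc k))" and ?P = "\<Prod>i = Suc a..k. fgl b x (y i)"
  show ?case
  proof (cases "k = a")
    case True
    have "(x - z) * branch_sum b y x z a (Suc k)
        = ((1 + b * z) * ?r - (1 + b * x) * fgl b z (y (Suc k))) * fpow b y z a"
      using True by (simp add: fgl_exchange)
    then show ?thesis
      using True by (simp add: fpow_Suc algebra_simps)
  next
    case False
    with Suc.prems have "a < k" by simp
    then have "(x - z) * branch_sum b y x z a (Suc k)
        = ?r * ((x - z) * branch_sum b y x z a k)
          + (1 + b * ?r) * (x - z) * fpow b y z k"
      by (simp add: algebra_simps)
    also have "\<dots> = (1 + b * z) * (?P * ?r) * fpow b y z a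
        + ((1 + b * ?r) * (x - z) - (1 + b * x) * ?r) * fpow b y z k"
      by (simp only: Suc.IH[OF \<open>a < k\<close>]) (simp add: algebra_simps)
    also have "\<dots> = (1 + b * z) * (?P * ?r) * fpow b y z a
        - (1 + b * x) * fpow b y z (Suc k)"
      by (simp only: fgl_cross fpow_Suc) (simp add: algebra_simps)
    finally show ?thesis
      using Suc.prems by simp
  qed
qed simp

lemma fpow_split:
  assumes "a \<le> k"
  shows "fpow b y x k = (\<Prod>i = Suc a..k. fgl b x (y i)) * fpow b y x a"
proof -
  have "{1..k} = {1..a} \<union> {Suc a..k}" "{1..a} \<inter> {Suc a..k} = {}"
    using assms by auto
  then show ?thesis
    unfolding fpow_def by (simp add: prod.union_disjoint mult.commute)
qed

lemma det_column_linear: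
  fixes A B C :: "'a::comm_ring_1 mat"
  assumes A: "A \<in> carrier_mat n n" and B: "B \<in> carrier_mat n n" and C: "C \<in> carrier_mat n n"
    and l: "l < n"
    and col: "\<And>i. i < n \<Longrightarrow> C $$ (i, l) = p * A $$ (i, l) + q * B $$ (i, l)"
    and other: "\<And>i j. i < n \<Longrightarrow> j < n \<Longrightarrow> j \<noteq> l \<Longrightarrow> A $$ (i, j) = C $$ (i, j) \<and> B $$ (i, j) = C $$ (i, j)"
  shows "det C = p * det A + q * det B"
proof -
  have "mat_delete A i l = mat_delete C i l" "mat_delete B i l = mat_delete C i l" if "i < n" for i
    using A B C that by (auto simp: mat_delete_def intro!: eq_matI other[THEN conjunct1] other[THEN conjunct2])
  then have cof: "cofactor A i l = cofactor C i l" "cofactor B i l = cofactor C i l" if "i < n" for i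
    using that by (simp_all add: cofactor_def)
  have "det C = (\<Sum>i<n. C $$ (i, l) * cofactor C i l)"
    by (rule laplace_expansion_column[OF C l])
  also have "\<dots> = (\<Sum>i<n. p * (A $$ (i, l) * cofactor A i l) + q * (B $$ (i, l) * cofactor B i l))"
    by (intro sum.cong refl) (simp add: col cof algebra_simps)
  also have "\<dots> = p * det A + q * det B"
    by (simp add: sum.distrib sum_distrib_left laplace_expansion_column[OF A l] laplace_expansion_column[OF B l])
  finally show ?thesis .
qed

lemma det_scale_rows:
  fixes g :: "nat \<Rightarrow> nat \<Rightarrow> 'a::comm_ring_1"
  shows "det (mat n n (\<lambda>(i, j). s i * g i j)) = (\<Prod>i<n. s i) * det (mat n n (\<lambda>(i, j). g i j))"
proof -
  let ?D = "mat n n (\<lambda>(i, j). if i = j then s i else 0)"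
  have "mat n n (\<lambda>(i, j). s i * g i j) = ?D * mat n n (\<lambda>(i, j). g i j)"
    by (intro eq_matI) (auto simp: scalar_prod_def if_distrib[of "\<lambda>t. t * _"] sum.delta cong: if_cong)
  moreover have "det ?D = (\<Prod>i<n. s i)"
    by (subst det_lower_triangular[of n]) (auto simp: prod_list_diag_prod atLeast0LessThan intro!: prod.cong)
  ultimately show ?thesis
    by (simp add: det_mult[of _ n])
qed

text \<open>
  The branching rule for the bialternants: removing the variable \<open>x\<^sub>0\<close> replaces each column by a
  branching sum. By the closed form of these sums, the column operations
  \<open>C\<^sub>j \<mapsto> (1 + b x\<^sub>0) C\<^sub>j - R\<^sub>j C\<^bsub>j+1\<^esub>\<close> produce them up to the factors \<open>x\<^sub>0 - x\<^sub>i\<close> and clear the top row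
  outside the last column. They multiply the determinant by \<open>(1 + b x\<^sub>0)\<^sup>d\<close>, which cancels against
  the remaining entry of the top row.
\<close>

lemma branching_det:
  fixes b :: "'a::idom" and x y :: "nat \<Rightarrow> 'a" and c :: "nat \<Rightarrow> nat"
  assumes dec: "\<And>j. j < d \<Longrightarrow> c (Suc j) < c j"
    and nz: "1 + b * x 0 \<noteq> 0"
  shows "det (mat (Suc d) (Suc d) (\<lambda>(i, j). fpow b y (x i) (c j) * (1 + b * x i) ^ j))
    = (\<Prod>i<d. x 0 - x (Suc i)) * fpow b y (x 0) (c d)
      * det (mat d d (\<lambda>(i, j).
          branch_sum b y (x 0) (x (Suc i)) (c (Suc j)) (c j) * (1 + b * x (Suc i)) ^ j))"
proof -
  define f where "f i j = fpow b y (x i) (c j) * (1 + b * x i) ^ j" for i j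
  define R where "R j = (\<Prod>i = Suc (c (Suc j))..c j. fgl b (x 0) (y i))" for j
  define S where "S i j = branch_sum b y (x 0) (x (Suc i)) (c (Suc j)) (c j) * (1 + b * x (Suc i)) ^ j" for i j
  define M where "M = mat (Suc d) (Suc d) (\<lambda>(i, j). f i j)"
  define U where "U = mat (Suc d) (Suc d) (\<lambda>(k, j).
     if j = d then (if k = d then 1 else 0)
     else if k = j then 1 + b * x 0 else if k = Suc j then - R j else 0)"
  define W where "W = M * U"
  have carr: "M \<in> carrier_mat (Suc d) (Suc d)" "U \<in> carrier_mat (Suc d) (Suc d)"
    by (simp_all add: M_def U_def)
  have detU: "det U = (1 + b * x 0) ^ d"
  proof -
    have "det U = (\<Prod>k<Suc d. U $$ (k, k))"
      by (subst det_lower_triangular[OF _ carr(2)])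
         (auto simp: U_def prod_list_diag_prod atLeast0LessThan simp del: prod.lessThan_Suc)
    also have "\<dots> = (\<Prod>k<d. 1 + b * x 0)"
      by (simp add: U_def)
    finally show ?thesis by simp
  qed
  have W_entry: "W $$ (i, j) = (1 + b * x 0) * f i j - R j * f i (Suc j)" if "i < Suc d" "j < d" for i j
  proof -
    have "W $$ (i, j) = (\<Sum>k<Suc d. f i k * U $$ (k, j))"
      using that by (simp add: W_def M_def U_def scalar_prod_def atLeast0LessThan)
    also have "\<dots> = (\<Sum>k\<in>{j, Suc j}. f i k * U $$ (k, j))"
      using that by (intro sum.mono_neutral_right) (auto simp: U_def)
    also have "\<dots> = (1 + b * x 0) * f i j - R j * f i (Suc j)"
      using that by (simp add: U_def algebra_simps)
    finally show ?thesis .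
  qed
  have W_last: "W $$ (0, d) = f 0 d"
  proof -
    have "W $$ (0, d) = (\<Sum>k<Suc d. f 0 k * U $$ (k, d))"
      by (simp add: W_def M_def U_def scalar_prod_def atLeast0LessThan)
    also have "\<dots> = f 0 d"
      by (simp add: U_def)
    finally show ?thesis .
  qed
  have W_top: "W $$ (0, j) = 0" if "j < d" for j
  proof -
    have "fpow b y (x 0) (c j) = R j * fpow b y (x 0) (c (Suc j))"
      unfolding R_def by (rule fpow_split) (use dec that in \<open>auto intro: less_imp_le\<close>)
    then show ?thesis
      using that by (simp add: W_entry f_def algebra_simps)
  qed
  have W_low: "W $$ (Suc i, j) = - (x 0 - x (Suc i)) * S i j" if "i < d" "j < d" for i j
  proof -
    have "- (x 0 - x (Suc i)) * S i j
        = - (((x 0 - x (Suc i)) * branch_sum b y (x 0) (x (Suc i)) (c (Suc j)) (c j))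
             * (1 + b * x (Suc i)) ^ j)"
      by (simp add: S_def algebra_simps)
    also have "\<dots> = (1 + b * x 0) * f (Suc i) j - R j * f (Suc i) (Suc j)"
      by (simp only: branch_sum_closed[OF dec[OF that(2)]] f_def R_def) (simp add: algebra_simps)
    finally show ?thesis
      using that by (simp add: W_entry)
  qed
  have minor: "mat_delete W 0 d = mat d d (\<lambda>(i, j). - (x 0 - x (Suc i)) * S i j)"
    using W_low by (intro eq_matI) (auto simp: mat_delete_def W_def M_def U_def simp del: index_mult_mat(1))
  have "(1 + b * x 0) ^ d * det M = det W"
    using det_mult[OF carr] by (simp add: detU W_def)
  also have "\<dots> = (\<Sum>j<Suc d. W $$ (0, j) * cofactor W 0 j)"
    by (rule laplace_expansion_row) (use carr in \<open>auto simp: W_def\<close>)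
  also have "\<dots> = f 0 d * cofactor W 0 d"
    by (simp add: W_top W_last)
  also have "cofactor W 0 d = (-1) ^ d * ((\<Prod>i<d. - (x 0 - x (Suc i))) * det (mat d d (\<lambda>(i, j). S i j)))"
    unfolding cofactor_def minor by (subst det_scale_rows) simp
  also have "(\<Prod>i<d. - (x 0 - x (Suc i))) = (-1) ^ d * (\<Prod>i<d. x 0 - x (Suc i))"
    by (induction d) (auto simp: algebra_simps)
  finally have "(1 + b * x 0) ^ d * det M
      = f 0 d * ((\<Prod>i<d. x 0 - x (Suc i)) * det (mat d d (\<lambda>(i, j). S i j)))"
    by (simp add: mult.assoc[symmetric] power_mult_distrib[symmetric])
  also have "\<dots> = (1 + b * x 0) ^ d
      * ((\<Prod>i<d. x 0 - x (Suc i)) * fpow b y (x 0) (c d) * det (mat d d (\<lambda>(i, j). S i j)))"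
    by (simp add: f_def algebra_simps)
  finally show ?thesis
    using nz by (simp add: M_def f_def S_def)
qed

lemma prod_pairs_split:
  fixes g :: "nat \<Rightarrow> nat \<Rightarrow> 'a::comm_monoid_mult"
  assumes "m \<le> n"
  shows "(\<Prod>(i, j) \<in> {(i, j). m \<le> i \<and> i < j \<and> j \<le> n}. g i j)
    = (\<Prod>j = Suc m..n. g m j) * (\<Prod>(i, j) \<in> {(i, j). Suc m \<le> i \<and> i < j \<and> j \<le> n}. g i j)"
proof -
  let ?P = "\<lambda>m. {(i, j). m \<le> i \<and> i < j \<and> j \<le> n}"
  have fin: "finite (?P k)" for k
    by (rule finite_subset[of _ "{..n} \<times> {..n}"]) auto
  have "?P m = Pair m ` {Suc m..n} \<union> ?P (Suc m)" "Pair m ` {Suc m..n} \<inter> ?P (Suc m) = {}"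
    by (auto simp: Suc_le_eq le_less image_iff)
  then have "(\<Prod>(i, j) \<in> ?P m. g i j)
      = (\<Prod>(i, j) \<in> Pair m ` {Suc m..n}. g i j) * (\<Prod>(i, j) \<in> ?P (Suc m). g i j)"
    using fin by (simp add: prod.union_disjoint)
  then show ?thesis
    by (subst (asm) prod.reindex) (auto simp: inj_on_def)
qed

text \<open>
  The case \<open>b = 0\<close>, \<open>y = 0\<close> of the branching rule with consecutive exponents, where each branching sum
  has a single term.
\<close>

lemma vandermonde_det:
  fixes x :: "nat \<Rightarrow> 'a::idom"
  shows "det (mat d d (\<lambda>(i, j). x (m + i) ^ (d - Suc j)))
    = (\<Prod>(i, j) \<in> {(i, j). m \<le> i \<and> i < j \<and> j < m + d}. x i - x j)"
proof (induction d arbitrary: m)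
  case 0
  have "{(i, j). m \<le> i \<and> i < j \<and> j < m + 0} = {}" by auto
  then show ?case by (simp only: prod.empty) simp
next
  case (Suc d)
  have pow: "fpow 0 (\<lambda>_. 0) z k = z ^ k" for z :: 'a and k
    by (simp add: fpow_def fgl_def)
  have "det (mat (Suc d) (Suc d) (\<lambda>(i, j). x (m + i) ^ (Suc d - Suc j)))
      = (\<Prod>i<d. x m - x (Suc (m + i)))
        * det (mat d d (\<lambda>(i, j). branch_sum 0 (\<lambda>_. 0) (x m) (x (Suc (m + i))) (d - Suc j) (d - j)))"
    using branching_det[of d "\<lambda>j. d - j" 0 "\<lambda>i. x (m + i)" "\<lambda>_. 0"] by (simp add: pow)
  also have "mat d d (\<lambda>(i, j). branch_sum 0 (\<lambda>_. 0) (x m) (x (Suc (m + i))) (d - Suc j) (d - j))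
      = mat d d (\<lambda>(i, j). x (Suc m + i) ^ (d - Suc j))"
    by (intro eq_matI) (auto simp: pow Suc_diff_Suc[symmetric] simp del: diff_Suc_Suc)
  also have "(\<Prod>i<d. x m - x (Suc (m + i))) = (\<Prod>j = Suc m..m + d. x m - x j)"
    by (rule prod.reindex_bij_witness[of _ "\<lambda>j. j - Suc m" "\<lambda>i. Suc (m + i)"]) auto
  finally show ?case
    using prod_pairs_split[of m "m + d" "\<lambda>i j. x i - x j"] Suc.IH[of "Suc m"]
    by (simp add: less_Suc_eq_le)
qed

section \<open>The ideal of relations\<close>

lemma carrier_free_alg:
  "f \<in> carrier (free_alg N) \<longleftrightarrow> (\<forall>u \<in> Poly_Mapping.keys f. set (letters u) \<subseteq> {1..<N})"
  by (simp add: free_alg_def)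

lemma free_alg_simps [simp]:
  "f \<otimes>\<^bsub>free_alg N\<^esub> g = f * g" "f \<oplus>\<^bsub>free_alg N\<^esub> g = f + g"
  "\<one>\<^bsub>free_alg N\<^esub> = 1" "\<zero>\<^bsub>free_alg N\<^esub> = 0"
  by (simp_all add: free_alg_def)

lemma letters_simps [simp]: "letters 0 = []" "letters (u + v) = letters u @ letters v"
  by (simp_all add: zero_word_monoid_def plus_word_monoid_def)

lemma add_in_free_alg:
  "f \<in> carrier (free_alg N) \<Longrightarrow> g \<in> carrier (free_alg N) \<Longrightarrow> f + g \<in> carrier (free_alg N)"
  using Poly_Mapping.keys_add[of f g] unfolding carrier_free_alg by blast

lemma mult_in_free_alg:
  "f \<in> carrier (free_alg N) \<Longrightarrow> g \<in> carrier (free_alg N) \<Longrightarrow> f * g \<in> carrier (free_alg N)"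
  using keys_mult[of f g] unfolding carrier_free_alg by fastforce

lemma single_in_free_alg:
  "set (letters u) \<subseteq> {1..<N} \<Longrightarrow> Poly_Mapping.single u c \<in> carrier (free_alg N)"
  by (simp add: carrier_free_alg)

lemma wd_in_free_alg: "set ks \<subseteq> {1..<N} \<Longrightarrow> wd ks \<in> carrier (free_alg N)"
  by (simp add: wd_def single_in_free_alg)

lemma gen_in_free_alg: "i \<in> {1..<N} \<Longrightarrow> gen i \<in> carrier (free_alg N)"
  by (simp add: gen_def wd_in_free_alg)

lemma scal_in_free_alg [simp]: "scal c \<in> carrier (free_alg N)"
  by (simp add: scal_def single_in_free_alg)

lemma scal_1: "scal 1 = 1"
  by (simp add: scal_def)

lemma scal_minus_1: "scal (- 1) = - 1"
  by (simp add: scal_def single_uminus)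

lemma one_in_free_alg [simp]: "1 \<in> carrier (free_alg N)"
  using scal_in_free_alg[of 1] by (simp only: scal_1)

lemma zero_in_free_alg [simp]: "0 \<in> carrier (free_alg N)"
  by (simp add: carrier_free_alg)

lemma uminus_in_free_alg: "f \<in> carrier (free_alg N) \<Longrightarrow> - f \<in> carrier (free_alg N)"
  by (simp add: carrier_free_alg)

lemma sum_in_free_alg:
  "(\<And>i. i \<in> S \<Longrightarrow> f i \<in> carrier (free_alg N)) \<Longrightarrow> (\<Sum>i\<in>S. f i) \<in> carrier (free_alg N)"
  by (induction S rule: infinite_finite_induct) (auto intro: add_in_free_alg)

lemma ring_free_alg: "ring (free_alg N)"
proof (intro ringI abelian_groupI monoidI)
  fix f assume "f \<in> carrier (free_alg N)"
  then show "\<exists>g\<in>carrier (free_alg N). g \<oplus>\<^bsub>free_alg N\<^esub> f = \<zero>\<^bsub>free_alg N\<^esub>"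
    by (intro bexI[of _ "- f"]) (auto intro: uminus_in_free_alg)
qed (auto intro: add_in_free_alg mult_in_free_alg simp: algebra_simps)

lemma a_minus_free_alg:
  assumes "f \<in> carrier (free_alg N)" "g \<in> carrier (free_alg N)"
  shows "f \<ominus>\<^bsub>free_alg N\<^esub> g = f - g"
proof -
  interpret ring "free_alg N" by (rule ring_free_alg)
  have "\<ominus>\<^bsub>free_alg N\<^esub> g = - g"
    using assms(2) by (intro minus_equality) (auto intro: uminus_in_free_alg)
  then show ?thesis
    by (simp add: a_minus_def)
qed

lemma wd_append: "wd (ks @ ls) = wd ks * wd ls"
  by (simp add: wd_def mult_single plus_word_monoid_def)

lemma wd_Nil: "wd [] = 1"
  by (simp add: wd_def zero_word_monoid_def[symmetric])

lemma wd_Cons: "wd (i # ks) = gen i * wd ks"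
  using wd_append[of "[i]" ks] by (simp add: gen_def)

lemma scal_mult: "scal (c * d) = scal c * scal d"
  by (simp add: scal_def mult_single)

lemma scal_add: "scal (c + d) = scal c + scal d"
  by (simp add: scal_def single_add)

lemma scal_0: "scal 0 = 0"
  by (simp add: scal_def)

lemma scal_sum: "scal (\<Sum>i\<in>S. c i) = (\<Sum>i\<in>S. scal (c i))"
  by (induction S rule: infinite_finite_induct) (simp_all add: scal_0 scal_add)

lemma wd_scal_commute: "wd ks * scal c = scal c * wd ks"
  by (simp add: wd_def scal_def mult_single)

lemma single_eq_scal_wd: "Poly_Mapping.single u c = scal c * wd (letters u)"
  by (simp add: scal_def wd_def mult_single)

lemma poly_mapping_sum_singles:
  "f = (\<Sum>u\<in>Poly_Mapping.keys f. Poly_Mapping.single u (Poly_Mapping.lookup f u))"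
proof (rule poly_mapping_eqI)
  fix v
  show "Poly_Mapping.lookup f v = Poly_Mapping.lookup
      (\<Sum>u\<in>Poly_Mapping.keys f. Poly_Mapping.single u (Poly_Mapping.lookup f u)) v"
    by (auto simp: lookup_sum lookup_single when_def in_keys_iff)
qed

lemma idc_relators_in_free_alg: "idc_relators N \<subseteq> carrier (free_alg N)"
proof -
  have minus: "f - g \<in> carrier (free_alg N)"
    if "f \<in> carrier (free_alg N)" "g \<in> carrier (free_alg N)" for f g
    using add_in_free_alg[OF that(1) uminus_in_free_alg[OF that(2)]] by simp
  show ?thesis
    unfolding idc_relators_def
    by (auto simp: gen_in_free_alg intro!: minus mult_in_free_alg)
qed

lemma ideal_idc_ideal: "ideal (idc_ideal N) (free_alg N)"
  unfolding idc_ideal_def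
  by (rule ring.genideal_ideal[OF ring_free_alg idc_relators_in_free_alg])

text \<open>
  Congruence modulo the ideal of relations. On the carrier it is equality of classes in \<^term>\<open>IdC N\<close>.
\<close>

definition idc_cong :: "nat \<Rightarrow> free_algebra \<Rightarrow> free_algebra \<Rightarrow> bool" where
  "idc_cong N f g \<longleftrightarrow> f - g \<in> idc_ideal N"

lemma idc_ideal_add: "f \<in> idc_ideal N \<Longrightarrow> g \<in> idc_ideal N \<Longrightarrow> f + g \<in> idc_ideal N"
  using additive_subgroup.a_closed[OF ideal.axioms(1)[OF ideal_idc_ideal[of N]]] by simp

lemma idc_ideal_lmult: "f \<in> carrier (free_alg N) \<Longrightarrow> g \<in> idc_ideal N \<Longrightarrow> f * g \<in> idc_ideal N"
  using ideal.I_l_closed[OF ideal_idc_ideal[of N]] by simp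

lemma idc_ideal_rmult: "f \<in> carrier (free_alg N) \<Longrightarrow> g \<in> idc_ideal N \<Longrightarrow> g * f \<in> idc_ideal N"
  using ideal.I_r_closed[OF ideal_idc_ideal[of N]] by simp

lemma idc_cong_refl: "idc_cong N f f"
  using additive_subgroup.zero_closed[OF ideal.axioms(1)[OF ideal_idc_ideal[of N]]]
  by (simp add: idc_cong_def)

lemma idc_cong_sym: "idc_cong N f g \<Longrightarrow> idc_cong N g f"
  using idc_ideal_lmult[OF scal_in_free_alg[of "- 1" N], of "f - g"]
  by (simp add: idc_cong_def scal_minus_1)

lemma idc_cong_trans [trans]: "idc_cong N f g \<Longrightarrow> idc_cong N g h \<Longrightarrow> idc_cong N f h"
  using idc_ideal_add[of "f - g" N "g - h"] by (simp add: idc_cong_def)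

lemma idc_cong_add: "idc_cong N f g \<Longrightarrow> idc_cong N f' g' \<Longrightarrow> idc_cong N (f + f') (g + g')"
  using idc_ideal_add[of "f - g" N "f' - g'"] by (simp add: idc_cong_def algebra_simps)

lemma idc_cong_lmult:
  "h \<in> carrier (free_alg N) \<Longrightarrow> idc_cong N f g \<Longrightarrow> idc_cong N (h * f) (h * g)"
  using idc_ideal_lmult[of h N "f - g"] by (simp add: idc_cong_def algebra_simps)

lemma idc_cong_rmult:
  "h \<in> carrier (free_alg N) \<Longrightarrow> idc_cong N f g \<Longrightarrow> idc_cong N (f * h) (g * h)"
  using idc_ideal_rmult[of h N "f - g"] by (simp add: idc_cong_def algebra_simps)

lemma idc_cong_sum:
  "(\<And>i. i \<in> S \<Longrightarrow> idc_cong N (f i) (g i)) \<Longrightarrow> idc_cong N (\<Sum>i\<in>S. f i) (\<Sum>i\<in>S. g i)"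
  by (induction S rule: infinite_finite_induct) (auto intro: idc_cong_add idc_cong_refl)

lemma idc_class_eq_iff:
  assumes "f \<in> carrier (free_alg N)" "g \<in> carrier (free_alg N)"
  shows "idc_class N f = idc_class N g \<longleftrightarrow> idc_cong N f g"
  using ring.quotient_eq_iff_same_a_r_cos[OF ring_free_alg ideal_idc_ideal assms]
  by (simp add: idc_class_def idc_cong_def a_minus_free_alg[OF assms])

lemma relator_in_idc_ideal: "r \<in> idc_relators N \<Longrightarrow> r \<in> idc_ideal N"
  unfolding idc_ideal_def
  using ring.genideal_self[OF ring_free_alg idc_relators_in_free_alg] by blast

lemma idc_cong_commute:
  assumes "i \<in> {1..<N}" "j \<in> {1..<N}" "\<bar>int i - int j\<bar> \<ge> 2"
  shows "idc_cong N (gen i * gen j) (gen j * gen i)"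
  unfolding idc_cong_def
  by (rule relator_in_idc_ideal) (use assms in \<open>auto simp: idc_relators_def\<close>)

lemma idc_cong_braid:
  assumes "i \<in> {1..<N}" "j \<in> {1..<N}" "\<bar>int i - int j\<bar> = 1"
  shows "idc_cong N (gen i * gen j * gen i) (gen j * gen i * gen j)"
  unfolding idc_cong_def
  by (rule relator_in_idc_ideal) (use assms in \<open>auto simp: idc_relators_def\<close>)

lemma idc_cong_quadratic:
  assumes "i \<in> {1..<N}"
  shows "idc_cong N (gen i * gen i) (scal bet * gen i)"
  unfolding idc_cong_def
  by (rule relator_in_idc_ideal) (use assms in \<open>auto simp: idc_relators_def\<close>)


section \<open>The representation on permutations\<close>

text \<open>
  The operator of \<open>e\<^sub>i\<close> on the module with basis the permutations, on which \<open>e\<^sub>i\<close> sends \<open>w\<close> to \<open>s\<^sub>i w\<close> if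
  this is longer than \<open>w\<close>, and to \<open>\<beta> w\<close> otherwise. An element of the module is written as its
  coefficient function, and \<open>w\<close> is recorded by \<open>u = w\<^sup>-\<^sup>1\<close>, so that \<open>s\<^sub>i w\<close> becomes \<open>u \<circ> s\<^sub>i\<close> and \<open>s\<^sub>i w\<close> is
  longer than \<open>w\<close> exactly if \<open>u i < u (i + 1)\<close>. The formula makes sense, and satisfies the relations,
  for arbitrary functions \<open>u\<close>.
\<close>

definition eop ::
  "nat \<Rightarrow> ((nat \<Rightarrow> nat) \<Rightarrow> coeff_ring) \<Rightarrow> (nat \<Rightarrow> nat) \<Rightarrow> coeff_ring" where
  "eop i \<phi> u = (if u (Suc i) < u i then \<phi> (u \<circ> transpose i (Suc i)) + bet * \<phi> u else 0)"

text \<open>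
  The operator of a word in the generators, and, by linear extension, of an element of the free
  algebra.
\<close>

definition wop ::
  "nat list \<Rightarrow> ((nat \<Rightarrow> nat) \<Rightarrow> coeff_ring) \<Rightarrow> (nat \<Rightarrow> nat) \<Rightarrow> coeff_ring" where
  "wop ks = foldr eop ks"

definition rep ::
  "free_algebra \<Rightarrow> ((nat \<Rightarrow> nat) \<Rightarrow> coeff_ring) \<Rightarrow> (nat \<Rightarrow> nat) \<Rightarrow> coeff_ring" where
  "rep f \<phi> u = (\<Sum>k\<in>Poly_Mapping.keys f. Poly_Mapping.lookup f k * wop (letters k) \<phi> u)"

lemma wop_simps [simp]: "wop [] \<phi> = \<phi>" "wop (i # ks) \<phi> = eop i (wop ks \<phi>)"
  by (simp_all add: wop_def)

lemma wop_append: "wop (ks @ ls) \<phi> = wop ks (wop ls \<phi>)"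
  by (simp add: wop_def)

lemma eop_sum: "eop i (\<lambda>u. \<Sum>k\<in>S. c k * \<psi> k u) = (\<lambda>u. \<Sum>k\<in>S. c k * eop i (\<psi> k) u)"
  by (rule ext) (auto simp: eop_def sum_distrib_left sum.distrib[symmetric] algebra_simps)

lemma wop_sum: "wop ks (\<lambda>u. \<Sum>k\<in>S. c k * \<psi> k u) = (\<lambda>u. \<Sum>k\<in>S. c k * wop ks (\<psi> k) u)"
  by (induction ks) (simp_all add: eop_sum)

lemma rep_add: "rep (f + g) \<phi> u = rep f \<phi> u + rep g \<phi> u"
  unfolding rep_def
  by (rule setsum_keys_plus_distrib[where f = "\<lambda>k c. c * wop (letters k) \<phi> u"])
     (simp_all add: distrib_right)

lemma rep_0: "rep 0 \<phi> u = 0"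
  by (simp add: rep_def)

lemma rep_sum: "rep (\<Sum>i\<in>S. f i) \<phi> u = (\<Sum>i\<in>S. rep (f i) \<phi> u)"
  by (induction S rule: infinite_finite_induct) (simp_all add: rep_add rep_0)

lemma rep_single: "rep (Poly_Mapping.single k c) \<phi> u = c * wop (letters k) \<phi> u"
  by (simp add: rep_def)

lemma rep_diff: "rep (f - g) \<phi> u = rep f \<phi> u - rep g \<phi> u"
  using rep_add[of "f - g" g \<phi> u] by simp

lemma rep_single_mult:
  "rep (Poly_Mapping.single k c * g) \<phi> u = rep (Poly_Mapping.single k c) (rep g \<phi>) u"
proof -
  have "Poly_Mapping.single k c * g = (\<Sum>l\<in>Poly_Mapping.keys g.
      Poly_Mapping.single (k + l) (c * Poly_Mapping.lookup g l))"
    by (subst (1) poly_mapping_sum_singles[of g]) (simp add: sum_distrib_left mult_single)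
  then have "rep (Poly_Mapping.single k c * g) \<phi> u
      = (\<Sum>l\<in>Poly_Mapping.keys g. c * (Poly_Mapping.lookup g l
          * wop (letters k) (wop (letters l) \<phi>) u))"
    by (simp add: rep_sum rep_single wop_append mult.assoc)
  also have "\<dots> = c * wop (letters k) (rep g \<phi>) u"
    unfolding rep_def[abs_def] by (simp add: wop_sum sum_distrib_left)
  finally show ?thesis
    by (simp add: rep_single)
qed

lemma rep_mult: "rep (f * g) \<phi> = rep f (rep g \<phi>)"
proof
  fix u
  have "rep (f * g) \<phi> u = (\<Sum>k\<in>Poly_Mapping.keys f.
      rep (Poly_Mapping.single k (Poly_Mapping.lookup f k) * g) \<phi> u)"
    by (subst (1) poly_mapping_sum_singles[of f]) (simp add: sum_distrib_right rep_sum)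
  also have "\<dots> = rep f (rep g \<phi>) u"
    by (simp add: rep_single_mult rep_single) (simp add: rep_def)
  finally show "rep (f * g) \<phi> u = rep f (rep g \<phi>) u" .
qed

lemma rep_wd: "rep (wd ks) \<phi> = wop ks \<phi>"
  by (rule ext) (simp add: wd_def rep_single)

lemma rep_gen: "rep (gen i) \<phi> = eop i \<phi>"
  by (simp add: gen_def rep_wd)

lemma rep_scal: "rep (scal c) \<phi> u = c * \<phi> u"
  by (simp add: scal_def rep_single)

lemma rep_1: "rep 1 \<phi> = \<phi>"
  using rep_wd[of "[]"] by (simp add: wd_Nil)

lemma rep_zero_fun: "rep f (\<lambda>_. 0) u = 0"
proof -
  have "wop ks (\<lambda>_. 0) = (\<lambda>_. 0)" for ks
    using wop_sum[where S = "{} :: nat set"] by simp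
  then show ?thesis
    by (simp add: rep_def)
qed

lemma eop_eop: "eop i (eop i \<phi>) u = bet * eop i \<phi> u"
  by (simp add: eop_def)

lemma eop_commute:
  assumes "\<bar>int i - int j\<bar> \<ge> 2"
  shows "eop i (eop j \<phi>) u = eop j (eop i \<phi>) u"
proof -
  have "u \<circ> transpose j (Suc j) \<circ> transpose i (Suc i) = u \<circ> transpose i (Suc i) \<circ> transpose j (Suc j)"
    using assms by (auto simp: fun_eq_iff transpose_def)
  moreover have "transpose j (Suc j) i = i" "transpose j (Suc j) (Suc i) = Suc i"
    "transpose i (Suc i) j = j" "transpose i (Suc i) (Suc j) = Suc j"
    using assms by (auto simp: transpose_def)
  ultimately show ?thesis
    by (simp add: eop_def algebra_simps)
qed

lemma eop_braid: "eop i (eop (Suc i) (eop i \<phi>)) u = eop (Suc i) (eop i (eop (Suc i) \<phi>)) u"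
proof -
  define s t where "s = transpose i (Suc i)" and "t = transpose (Suc i) (Suc (Suc i))"
  have val: "s i = Suc i" "s (Suc i) = i" "s (Suc (Suc i)) = Suc (Suc i)"
    "t i = i" "t (Suc i) = Suc (Suc i)" "t (Suc (Suc i)) = Suc i"
    by (simp_all add: s_def t_def)
  have inv: "s (s k) = k" "t (t k) = k" for k
    by (simp_all add: s_def t_def)
  then have inv': "v \<circ> s \<circ> s = v" "v \<circ> t \<circ> t = v" for v :: "nat \<Rightarrow> nat"
    by (simp_all add: fun_eq_iff)
  have triple: "u \<circ> s \<circ> t \<circ> s = u \<circ> t \<circ> s \<circ> t"
    by (auto simp: fun_eq_iff s_def t_def transpose_def)
  have e: "eop i \<psi> v = (if v (Suc i) < v i then \<psi> (v \<circ> s) + bet * \<psi> v else 0)"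
    "eop (Suc i) \<psi> v = (if v (Suc (Suc i)) < v (Suc i) then \<psi> (v \<circ> t) + bet * \<psi> v else 0)"
    for \<psi> v
    by (simp_all add: eop_def s_def t_def)
  consider "u (Suc (Suc i)) < u (Suc i)" "u (Suc i) < u i" | "\<not> u (Suc (Suc i)) < u (Suc i)" "u (Suc i) < u i"
    | "u (Suc (Suc i)) < u (Suc i)" "\<not> u (Suc i) < u i" | "\<not> u (Suc (Suc i)) < u (Suc i)" "\<not> u (Suc i) < u i"
    by blast
  then show ?thesis
  proof cases
    case 1
    then have "u (Suc (Suc i)) < u i" by simp
    with 1 show ?thesis
      by (simp add: e val inv' triple) (simp add: algebra_simps)
  next
    case 2
    then show ?thesis
      by (simp add: e val inv')
  next
    case 3
    then show ?thesis
      by (simp add: e val inv')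
  next
    case 4
    then show ?thesis
      by (simp add: e val inv')
  qed
qed

text \<open>
  The operators therefore depend only on the class in \<^term>\<open>IdC N\<close>: the free algebra elements acting
  by zero form an ideal that contains the relators.
\<close>

lemma rep_idc_ideal:
  assumes "f \<in> idc_ideal N"
  shows "rep f \<phi> u = 0"
proof -
  let ?J = "{f \<in> carrier (free_alg N). \<forall>\<phi> u. rep f \<phi> u = 0}"
  interpret R: ring "free_alg N" by (rule ring_free_alg)
  have "ideal ?J (free_alg N)"
  proof (rule idealI[OF ring_free_alg])
    show "subgroup ?J (add_monoid (free_alg N))"
    proof (rule R.add.subgroupI)
      fix f assume f: "f \<in> ?J"
      then have "\<ominus>\<^bsub>free_alg N\<^esub> f = - f"
        by (intro R.minus_equality) (auto intro: uminus_in_free_alg)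
      then show "\<ominus>\<^bsub>free_alg N\<^esub> f \<in> ?J"
        using f rep_diff[of 0 f] by (auto simp: rep_0 intro: uminus_in_free_alg)
    qed (auto simp: rep_add rep_0 intro: add_in_free_alg exI[of _ 0])
  next
    fix f g assume fg: "f \<in> ?J" "g \<in> carrier (free_alg N)"
    then have "rep f \<phi> = (\<lambda>_. 0)" for \<phi> by auto
    with fg show "g \<otimes>\<^bsub>free_alg N\<^esub> f \<in> ?J" "f \<otimes>\<^bsub>free_alg N\<^esub> g \<in> ?J"
      by (auto simp: rep_mult rep_zero_fun intro: mult_in_free_alg)
  qed
  moreover have "idc_relators N \<subseteq> ?J"
  proof
    fix r assume r: "r \<in> idc_relators N"
    then have "rep r \<phi> u = 0" for \<phi> u
      unfolding idc_relators_def
    proof (elim UnE CollectE exE conjE)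
      fix i j assume ij: "r = gen i * gen j * gen i - gen j * gen i * gen j" "\<bar>int i - int j\<bar> = 1"
      then consider "j = Suc i" | "i = Suc j" by linarith
      then show "rep r \<phi> u = 0"
        by cases (simp_all add: ij(1) rep_diff rep_mult rep_gen eop_braid)
    qed (simp_all add: rep_diff rep_mult rep_gen rep_scal eop_commute eop_eop)
    with r idc_relators_in_free_alg show "r \<in> ?J" by blast
  qed
  ultimately have "idc_ideal N \<subseteq> ?J"
    unfolding idc_ideal_def by (rule R.genideal_minimal)
  with assms show ?thesis by blast
qed

lemma rep_idc_cong: "idc_cong N f g \<Longrightarrow> rep f \<phi> u = rep g \<phi> u"
  using rep_idc_ideal[of "f - g" N \<phi> u] by (simp add: idc_cong_def rep_diff)

section \<open>Normal forms of words\<close>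

text \<open>
  The inverse of a function under a name of its own, since the prefix \<open>inv\<close> also denotes the inverse in a
  group.
\<close>

abbreviation (input) perm_inv :: "(nat \<Rightarrow> nat) \<Rightarrow> nat \<Rightarrow> nat" where
  "perm_inv \<equiv> inv_into UNIV"

lemma word_perm_Nil [simp]: "word_perm [] = id"
  by (simp add: word_perm_def)

lemma word_perm_Cons [simp]: "word_perm (i # ks) = transpose i (Suc i) \<circ> word_perm ks"
  by (simp add: word_perm_def)

lemma word_perm_append: "word_perm (ks @ ls) = word_perm ks \<circ> word_perm ls"
  by (induction ks) (simp_all add: comp_assoc)

lemma word_perm_permutes: "set ks \<subseteq> {1..<N} \<Longrightarrow> word_perm ks permutes {1..N}"
  by (induction ks) (auto intro!: permutes_compose permutes_swap_id)

lemma bij_word_perm: "bij (word_perm ks)"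
proof (induction ks)
  case (Cons i ks)
  then show "bij (word_perm (i # ks))" by (simp add: bij_comp)
next
  show "bij (word_perm [])" by simp
qed

text \<open>
  The consequences of the two length-preserving relations that are used: equal length, equal
  permutation and equal class.
\<close>

definition braid_equiv :: "nat \<Rightarrow> nat list \<Rightarrow> nat list \<Rightarrow> bool" where
  "braid_equiv N ks ls \<longleftrightarrow>
     length ks = length ls \<and> word_perm ks = word_perm ls \<and> idc_cong N (wd ks) (wd ls)"

lemma braid_equiv_refl: "braid_equiv N ks ks"
  by (simp add: braid_equiv_def idc_cong_refl)

lemma braid_equiv_trans [trans]:
  "braid_equiv N ks ls \<Longrightarrow> braid_equiv N ls ms \<Longrightarrow> braid_equiv N ks ms"
  by (auto simp: braid_equiv_def intro: idc_cong_trans)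

lemma braid_equiv_context:
  assumes "braid_equiv N ks ls" "set as \<subseteq> {1..<N}" "set bs \<subseteq> {1..<N}"
  shows "braid_equiv N (as @ ks @ bs) (as @ ls @ bs)"
proof -
  have "idc_cong N (wd as * (wd ks * wd bs)) (wd as * (wd ls * wd bs))"
    using assms unfolding braid_equiv_def
    by (intro idc_cong_lmult idc_cong_rmult wd_in_free_alg) simp_all
  then show ?thesis
    using assms by (simp add: braid_equiv_def wd_append word_perm_append)
qed

lemma braid_equiv_commute:
  assumes "i \<in> {1..<N}" "j \<in> {1..<N}" "Suc i < j"
  shows "braid_equiv N [i, j] [j, i]"
proof -
  have "idc_cong N (gen i * gen j) (gen j * gen i)"
    using assms by (intro idc_cong_commute) auto
  moreover have "word_perm [i, j] = word_perm [j, i]"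
    using assms by (auto simp: fun_eq_iff transpose_def)
  ultimately show ?thesis
    by (simp add: braid_equiv_def wd_Cons wd_Nil)
qed

lemma braid_equiv_sym: "braid_equiv N ks ls \<Longrightarrow> braid_equiv N ls ks"
  by (auto simp: braid_equiv_def intro: idc_cong_sym)

lemma braid_equiv_braid:
  assumes "i \<in> {1..<N}" "Suc i \<in> {1..<N}"
  shows "braid_equiv N [Suc i, i, Suc i] [i, Suc i, i]"
proof -
  have "idc_cong N (gen (Suc i) * gen i * gen (Suc i)) (gen i * gen (Suc i) * gen i)"
    using assms by (intro idc_cong_braid) auto
  moreover have "word_perm [Suc i, i, Suc i] = word_perm [i, Suc i, i]"
    by (auto simp: fun_eq_iff transpose_def)
  ultimately show ?thesis
    by (simp add: braid_equiv_def wd_Cons wd_Nil mult.assoc)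
qed

lemma pass_left_of_run:
  assumes "Suc i < a" "1 \<le> i" "b \<le> N"
  shows "braid_equiv N (i # [a..<b]) ([a..<b] @ [i])"
  using assms(3)
proof (induction b)
  case (Suc b)
  show ?case
  proof (cases "a \<le> b")
    case True
    have "braid_equiv N (i # [a..<Suc b]) (([a..<b] @ [i]) @ [b])"
      using braid_equiv_context[OF Suc.IH, of "[]" "[b]"] True Suc.prems assms by simp
    also have "braid_equiv N (([a..<b] @ [i]) @ [b]) ([a..<Suc b] @ [i])"
      using braid_equiv_context[OF braid_equiv_commute[of i N b], of "[a..<b]" "[]"]
        True Suc.prems assms by auto
    finally show ?thesis .
  qed (simp add: braid_equiv_refl)
qed (simp add: braid_equiv_refl)

text \<open>
  A letter of an increasing run, other than its first, passes through it and comes out lowered by one.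
\<close>

lemma pass_through_run:
  assumes "1 \<le> a" "a \<le> i" "Suc i < b" "b \<le> N"
  shows "braid_equiv N (Suc i # [a..<b]) ([a..<b] @ [i])"
proof -
  have split: "[a..<b] = [a..<i] @ [i, Suc i] @ [Suc (Suc i)..<b]"
  proof -
    have "[a..<b] = [a..<i] @ [i..<b]"
      using assms upt_add_eq_append[of a i "b - i"] by simp
    then show ?thesis
      using assms by (simp add: upt_conv_Cons)
  qed
  have comm: "braid_equiv N (Suc i # [a..<i]) ([a..<i] @ [Suc i])"
  proof -
    have "braid_equiv N (Suc i # [a..<c]) ([a..<c] @ [Suc i])" if "c \<le> i" for c
      using that
    proof (induction c)
      case (Suc c)
      show ?case
      proof (cases "a \<le> c")
        case True
        have "braid_equiv N (Suc i # [a..<Suc c]) (([a..<c] @ [Suc i]) @ [c])"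
          using braid_equiv_context[OF Suc.IH, of "[]" "[c]"] True Suc.prems assms by simp
        also have "braid_equiv N (([a..<c] @ [Suc i]) @ [c]) ([a..<Suc c] @ [Suc i])"
          using braid_equiv_context[OF braid_equiv_sym[OF braid_equiv_commute[of c N "Suc i"]],
              of "[a..<c]" "[]"] True Suc.prems assms by auto
        finally show ?thesis .
      qed (simp add: braid_equiv_refl)
    qed (simp add: braid_equiv_refl)
    then show ?thesis by simp
  qed
  let ?r = "[Suc (Suc i)..<b]"
  have "braid_equiv N (Suc i # [a..<b]) ([a..<i] @ [Suc i, i, Suc i] @ ?r)"
    using braid_equiv_context[OF comm, of "[]" "[i, Suc i] @ ?r"] assms by (auto simp: split)
  also have "braid_equiv N \<dots> ([a..<i] @ [i, Suc i, i] @ ?r)"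
    using assms by (intro braid_equiv_context braid_equiv_braid) auto
  also have "braid_equiv N \<dots> ([a..<i] @ [i, Suc i] @ ?r @ [i])"
    using braid_equiv_context[OF pass_left_of_run[of i "Suc (Suc i)" b N], of "[a..<i] @ [i, Suc i]" "[]"]
      assms by auto
  finally show ?thesis
    by (simp add: split)
qed

text \<open>
  A permutation of \<open>{1..M+1}\<close> that sends \<open>M+1\<close> to \<open>a\<close> is \<open>s\<^sub>a s\<^bsub>a+1\<^esub> \<cdots> s\<^sub>M\<close> times a permutation of \<open>{1..M}\<close>.
  Iterating this gives one word for each permutation.
\<close>

fun normal_words :: "nat \<Rightarrow> nat list set" where
  "normal_words 0 = {[]}"
| "normal_words (Suc M) = {[a..<Suc M] @ v | a v. 1 \<le> a \<and> a \<le> Suc M \<and> v \<in> normal_words M}"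

lemma normal_wordsI:
  "1 \<le> a \<Longrightarrow> a \<le> Suc M \<Longrightarrow> v \<in> normal_words M
    \<Longrightarrow> [a..<Suc M] @ v \<in> normal_words (Suc M)"
  unfolding normal_words.simps by blast

lemma Nil_in_normal_words: "[] \<in> normal_words M"
proof (induction M)
  case (Suc M)
  then have "[Suc M..<Suc M] @ [] \<in> normal_words (Suc M)"
    by (intro normal_wordsI) auto
  then show ?case by simp
qed simp

lemma normal_words_letters: "v \<in> normal_words M \<Longrightarrow> set v \<subseteq> {1..<M}"
proof (induction M arbitrary: v)
  case (Suc M)
  then obtain a t where "v = [a..<Suc M] @ t" "1 \<le> a" "set t \<subseteq> {1..<M}"
    by auto
  then show ?case by auto
qed simp

text \<open>
  Left multiplication by a generator stays within the normal words, up to a factor \<open>\<beta>\<close>. The factor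
  arises only from the quadratic relation; in that case the word was not reduced, which is the
  second alternative.
\<close>

lemma gen_times_normal_word:
  assumes "v \<in> normal_words M" "i \<in> {1..<M}" "M \<le> N"
  shows "(\<exists>v' \<in> normal_words M. braid_equiv N (i # v) v')
    \<or> (idc_cong N (wd (i # v)) (scal bet * wd v)
       \<and> (\<exists>ls. set ls \<subseteq> {1..<N} \<and> word_perm ls = word_perm (i # v) \<and> length ls < length (i # v)))"
  using assms
proof (induction M arbitrary: v i)
  case (Suc M)
  from Suc.prems(1) obtain a v0 where v: "v = [a..<Suc M] @ v0" and a: "1 \<le> a" "a \<le> Suc M"
    and v0: "v0 \<in> normal_words M"
    unfolding normal_words.simps by blast
  have run: "set [a..<Suc M] \<subseteq> {1..<N}" and v0_let: "set v0 \<subseteq> {1..<N}"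
    using a Suc.prems(3) normal_words_letters[OF v0] by auto
  \<comment> \<open>Once the letter has passed the run, the induction hypothesis applies to the shorter tail.\<close>
  have pass: ?case if k: "k \<in> {1..<M}" and eq: "braid_equiv N (i # [a..<Suc M]) ([a..<Suc M] @ [k])" for k
  proof -
    have iv: "braid_equiv N (i # v) ([a..<Suc M] @ (k # v0))"
      using braid_equiv_context[OF eq, of "[]" v0] v0_let by (simp add: v)
    have "M \<le> N"
      using Suc.prems(3) by simp
    from Suc.IH[OF v0 k this] consider
        v1 where "v1 \<in> normal_words M" "braid_equiv N (k # v0) v1"
      | ls where "idc_cong N (wd (k # v0)) (scal bet * wd v0)" "set ls \<subseteq> {1..<N}"
          "word_perm ls = word_perm (k # v0)" "length ls < length (k # v0)"
      by blast
    then show ?case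
    proof cases
      case 1
      have "braid_equiv N (i # v) ([a..<Suc M] @ v1)"
        using braid_equiv_trans[OF iv] braid_equiv_context[OF 1(2) run, of "[]"] by simp
      moreover have "[a..<Suc M] @ v1 \<in> normal_words (Suc M)"
        using a 1(1) by (rule normal_wordsI)
      ultimately show ?thesis by blast
    next
      case 2
      have "idc_cong N (wd (i # v)) (wd [a..<Suc M] * wd (k # v0))"
        using iv by (simp add: braid_equiv_def wd_append)
      also have "idc_cong N (wd [a..<Suc M] * wd (k # v0)) (wd [a..<Suc M] * (scal bet * wd v0))"
        using 2(1) run by (intro idc_cong_lmult wd_in_free_alg)
      also have "wd [a..<Suc M] * (scal bet * wd v0) = scal bet * wd v"
        by (simp only: v wd_append mult.assoc[symmetric] wd_scal_commute)
      finally have "idc_cong N (wd (i # v)) (scal bet * wd v)" .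
      moreover have "word_perm ([a..<Suc M] @ ls) = word_perm (i # v)"
        using iv 2(3) unfolding braid_equiv_def by (simp add: word_perm_append)
      moreover have "set ([a..<Suc M] @ ls) \<subseteq> {1..<N}" "length ([a..<Suc M] @ ls) < length (i # v)"
        using run 2(2,4) by (auto simp: v)
      ultimately show ?thesis by blast
    qed
  qed
  consider "Suc i < a" | "Suc i = a" | "i = a" | "a < i" by linarith
  then show ?case
  proof cases
    case 1
    with a Suc.prems(2,3) show ?thesis
      by (intro pass[of i] pass_left_of_run) auto
  next
    case 2
    then have "i # v = [i..<Suc M] @ v0"
      using Suc.prems(2) by (simp add: v upt_conv_Cons)
    moreover have "[i..<Suc M] @ v0 \<in> normal_words (Suc M)"
      using Suc.prems(2) v0 by (intro normal_wordsI) auto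
    ultimately have "i # v \<in> normal_words (Suc M)"
      by simp
    then show ?thesis
      using braid_equiv_refl by blast
  next
    case 3
    let ?t = "[Suc a..<Suc M] @ v0"
    have v': "v = a # ?t"
      using 3 Suc.prems(2) by (simp add: v upt_conv_Cons)
    have t: "set ?t \<subseteq> {1..<N}"
      using run v0_let a Suc.prems(3) by auto
    have "idc_cong N (gen a * gen a * wd ?t) (scal bet * gen a * wd ?t)"
      using 3 Suc.prems(2,3) t by (intro idc_cong_rmult idc_cong_quadratic wd_in_free_alg) auto
    then have "idc_cong N (wd (i # v)) (scal bet * wd v)"
      by (simp only: v' 3 wd_Cons mult.assoc)
    moreover have "word_perm ?t = word_perm (i # v)"
      by (simp add: v' 3 comp_assoc[symmetric])
    ultimately show ?thesis
      using t by (intro disjI2 conjI exI[of _ ?t]) (simp_all add: v')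
  next
    case 4
    then obtain k where k: "i = Suc k" by (cases i) auto
    have "k \<in> {1..<M}" "braid_equiv N (Suc k # [a..<Suc M]) ([a..<Suc M] @ [k])"
      using 4 a Suc.prems(2,3) by (auto simp only: k atLeastLessThan_iff intro!: pass_through_run)
    then show ?thesis
      by (intro pass[of k]) (simp_all add: k)
  qed
qed simp

lemma word_perm_run:
  assumes "a \<le> b"
  shows "word_perm [a..<b] b = a" and "k < a \<Longrightarrow> word_perm [a..<b] k = k"
proof -
  show "word_perm [a..<b] b = a"
    using assms
  proof (induction b)
    case (Suc b)
    then show ?case by (cases "a \<le> b") (simp_all add: word_perm_append)
  qed simp
  show "word_perm [a..<b] k = k" if "k < a"
    using that by (induction b) (simp_all add: word_perm_append transpose_def)
qed

lemma normal_word_fixes: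
  assumes "v \<in> normal_words M" "M < k"
  shows "word_perm v k = k"
  using permutes_not_in[OF word_perm_permutes[OF normal_words_letters[OF assms(1)]], of k] assms(2)
  by simp

lemma normal_word_unique:
  assumes "v \<in> normal_words M" "v' \<in> normal_words M" "word_perm v = word_perm v'"
  shows "v = v'"
  using assms
proof (induction M arbitrary: v v')
  case (Suc M)
  from Suc.prems(1,2) obtain a t a' t' where v: "v = [a..<Suc M] @ t" "v' = [a'..<Suc M] @ t'"
    and a: "a \<le> Suc M" "a' \<le> Suc M" and t: "t \<in> normal_words M" "t' \<in> normal_words M"
    unfolding normal_words.simps by blast
  have "word_perm v (Suc M) = a" "word_perm v' (Suc M) = a'"
    using a t by (simp_all only: v word_perm_append comp_apply normal_word_fixes word_perm_run lessI)
  then have aa: "a = a'"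
    using Suc.prems(3) by simp
  have "word_perm t = word_perm t'"
  proof
    fix k
    have "word_perm [a..<Suc M] (word_perm t k) = word_perm [a..<Suc M] (word_perm t' k)"
      using fun_cong[OF Suc.prems(3), of k] by (simp only: v aa word_perm_append comp_apply)
    then show "word_perm t k = word_perm t' k"
      by (rule injD[OF bij_is_inj[OF bij_word_perm]])
  qed
  then show ?case
    using Suc.IH[OF t] by (simp only: v aa)
qed simp

lemma normal_word_exists:
  assumes "w permutes {1..M}"
  shows "\<exists>v \<in> normal_words M. word_perm v = w"
  using assms
proof (induction M arbitrary: w)
  case (Suc M)
  define a where "a = w (Suc M)"
  have a: "1 \<le> a" "a \<le> Suc M"
    using permutes_in_image[OF Suc.prems, of "Suc M"] unfolding a_def by simp_all
  let ?r = "word_perm [a..<Suc M]"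
  have r: "?r permutes {1..Suc M}"
    using a by (intro word_perm_permutes) auto
  have fix_last: "(perm_inv ?r \<circ> w) (Suc M) = Suc M"
    using word_perm_run(1)[OF a(2)] permutes_inverses(2)[OF r, of "Suc M"]
    by (simp only: a_def[symmetric] comp_apply)
  have "perm_inv ?r \<circ> w permutes {1..M}"
  proof (rule permutes_superset[OF permutes_compose[OF Suc.prems permutes_inv[OF r]]])
    fix k assume "k \<in> {1..Suc M} - {1..M}"
    then have "k = Suc M" by auto
    with fix_last show "(perm_inv ?r \<circ> w) k = k" by (simp only:)
  qed
  from Suc.IH[OF this] obtain t where t: "t \<in> normal_words M" "word_perm t = perm_inv ?r \<circ> w"
    by blast
  have "word_perm ([a..<Suc M] @ t) = w"
    by (simp only: word_perm_append t(2) comp_assoc[symmetric] permutes_inv_o(1)[OF r] id_comp)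
  moreover have "[a..<Suc M] @ t \<in> normal_words (Suc M)"
    using a t(1) by (rule normal_wordsI)
  ultimately show ?case by blast
qed (auto simp: permutes_empty)

text \<open>
  The basis vector of the permutation with inverse \<open>u0\<close>.
\<close>

definition delta :: "(nat \<Rightarrow> nat) \<Rightarrow> (nat \<Rightarrow> nat) \<Rightarrow> coeff_ring" where
  "delta u0 u = (if u = u0 then 1 else 0)"

lemma eop_delta:
  assumes "u0 i < u0 (Suc i)"
  shows "eop i (delta u0) = delta (u0 \<circ> transpose i (Suc i))"
proof
  fix u
  have "u \<circ> transpose i (Suc i) = u0 \<longleftrightarrow> u = u0 \<circ> transpose i (Suc i)"
    by (auto simp: fun_eq_iff) (metis transpose_involutory)+
  moreover have "u0 \<circ> transpose i (Suc i) \<noteq> u0"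
    using assms by (auto dest: fun_cong[of _ _ i])
  ultimately show "eop i (delta u0) u = delta (u0 \<circ> transpose i (Suc i)) u"
    using assms by (auto simp: eop_def delta_def)
qed

lemma inv_word_perm_Cons: "perm_inv (word_perm (i # ks)) = perm_inv (word_perm ks) \<circ> transpose i (Suc i)"
  by (simp add: o_inv_distrib bij_word_perm)

lemma wop_run_delta:
  assumes "\<And>j. a \<le> j \<Longrightarrow> j < b \<Longrightarrow> u0 j < u0 b" "a \<le> b"
  shows "wop [a..<b] (delta u0) = delta (u0 \<circ> perm_inv (word_perm [a..<b]))"
  using assms(2,1)
proof (induction a rule: inc_induct)
  case (step a)
  let ?r = "word_perm [Suc a..<b]"
  have "inj ?r"
    by (rule bij_is_inj[OF bij_word_perm])
  moreover have "?r a = a" "?r b = Suc a"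
    using step.hyps by (intro word_perm_run; simp)+
  ultimately have "perm_inv ?r a = a" "perm_inv ?r (Suc a) = b"
    by (simp_all only: inv_f_eq)
  then have "eop a (delta (u0 \<circ> perm_inv ?r)) = delta (u0 \<circ> perm_inv ?r \<circ> transpose a (Suc a))"
    using step.hyps step.prems by (intro eop_delta) simp
  moreover have "wop [Suc a..<b] (delta u0) = delta (u0 \<circ> perm_inv ?r)"
    using step.IH step.prems by (simp add: comp_def)
  ultimately have "wop (a # [Suc a..<b]) (delta u0)
      = delta (u0 \<circ> perm_inv (word_perm (a # [Suc a..<b])))"
    by (simp add: inv_word_perm_Cons comp_assoc del: word_perm_Cons)
  then show "wop [a..<b] (delta u0) = delta (u0 \<circ> perm_inv (word_perm [a..<b]))"
    using step.hyps by (simp only: upt_conv_Cons)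
qed simp

text \<open>Normal words are reduced: each letter, read from the right, applies at an ascent.\<close>

lemma wop_normal_word:
  "v \<in> normal_words M \<Longrightarrow> wop v (delta id) = delta (perm_inv (word_perm v))"
proof (induction M arbitrary: v)
  case (Suc M)
  from Suc.prems obtain a t where v: "v = [a..<Suc M] @ t" and a: "1 \<le> a" "a \<le> Suc M"
    and t: "t \<in> normal_words M"
    unfolding normal_words.simps by blast
  have p: "perm_inv (word_perm t) permutes {1..M}"
    by (rule permutes_inv[OF word_perm_permutes[OF normal_words_letters[OF t]]])
  then have "wop [a..<Suc M] (delta (perm_inv (word_perm t)))
      = delta (perm_inv (word_perm t) \<circ> perm_inv (word_perm [a..<Suc M]))"
  proof (intro wop_run_delta a)
    fix j assume j: "a \<le> j" "j < Suc M"
    then have "perm_inv (word_perm t) j \<in> {1..M}"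
      using p a by (subst permutes_in_image) auto
    moreover have "perm_inv (word_perm t) (Suc M) = Suc M"
      using p by (auto simp: permutes_def)
    ultimately show "perm_inv (word_perm t) j < perm_inv (word_perm t) (Suc M)" by simp
  qed
  then show "wop v (delta id) = delta (perm_inv (word_perm v))"
    by (simp add: v wop_append Suc.IH[OF t] word_perm_append o_inv_distrib bij_word_perm del: upt_Suc)
qed simp

section \<open>The basis indexed by permutations\<close>

text \<open>
  Matsumoto's theorem in the form needed here: two reduced words of the same permutation have the same
  class, namely that of the normal word.
\<close>

lemma reduced_word_normal:
  assumes "reduced_word N w ks"
  shows "\<exists>v \<in> normal_words N. braid_equiv N ks v"
  using assms
proof (induction ks arbitrary: w)
  case Nil
  show ?case
    using Nil_in_normal_words by (intro bexI[of _ "[]"]) (auto simp: braid_equiv_refl)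
next
  case (Cons i ks)
  have min: "length (i # ks) \<le> length ls" if "set ls \<subseteq> {1..<N}" "word_perm ls = word_perm (i # ks)" for ls
    using Cons.prems that unfolding reduced_word_def is_arg_min_def by (auto simp: not_less)
  have let_ks: "i \<in> {1..<N}" "set ks \<subseteq> {1..<N}"
    using Cons.prems unfolding reduced_word_def is_arg_min_def by auto
  have "reduced_word N (word_perm ks) ks"
    unfolding reduced_word_def is_arg_min_def
  proof (intro conjI notI; (elim exE conjE)?)
    fix ls assume "set ls \<subseteq> {1..<N}" "word_perm ls = word_perm ks" "length ls < length ks"
    then show False
      using min[of "i # ls"] let_ks by simp
  qed (use let_ks in auto)
  from Cons.IH[OF this] obtain v where v: "v \<in> normal_words N" "braid_equiv N ks v" by blast
  have iv: "braid_equiv N (i # ks) (i # v)"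
    using braid_equiv_context[OF v(2), of "[i]" "[]"] let_ks by simp
  have "\<not> (length ls < length (i # v))" if "set ls \<subseteq> {1..<N}" "word_perm ls = word_perm (i # v)" for ls
    using min[OF that(1)] that(2) iv by (simp add: braid_equiv_def)
  with gen_times_normal_word[OF v(1) let_ks(1)] obtain v'
    where "v' \<in> normal_words N" "braid_equiv N (i # v) v'" by auto
  with iv show ?case
    by (blast intro: braid_equiv_trans)
qed

lemma e_perm_reduced:
  assumes "w permutes {1..N}"
  obtains ks where "reduced_word N w ks" "e_perm N w = wd ks"
proof -
  obtain v where v: "v \<in> normal_words N" "word_perm v = w"
    using normal_word_exists[OF assms] by blast
  let ?P = "\<lambda>ks. set ks \<subseteq> {1..<N} \<and> word_perm ks = w"
  have "?P v"
    using normal_words_letters[OF v(1)] v(2) by simp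
  then have "\<exists>ks. is_arg_min length ?P ks"
    unfolding is_arg_min_linorder using ex_has_least_nat[of ?P v length] by blast
  then have "reduced_word N w (SOME ks. reduced_word N w ks)"
    unfolding reduced_word_def by (rule someI_ex)
  then show thesis
    using that unfolding e_perm_def by blast
qed

lemma e_perm_cong_normal_word:
  assumes v: "v \<in> normal_words N"
  shows "idc_cong N (e_perm N (word_perm v)) (wd v)"
proof -
  obtain ks where ks: "reduced_word N (word_perm v) ks" "e_perm N (word_perm v) = wd ks"
    using e_perm_reduced[OF word_perm_permutes[OF normal_words_letters[OF v]]] by blast
  from reduced_word_normal[OF ks(1)] obtain v' where v': "v' \<in> normal_words N" "braid_equiv N ks v'"
    by blast
  have "word_perm v' = word_perm v"
    using v'(2) ks(1) by (simp add: braid_equiv_def reduced_word_def is_arg_min_def)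
  then have "v' = v"
    using normal_word_unique v v'(1) by blast
  with v' ks(2) show ?thesis
    by (simp add: braid_equiv_def)
qed

lemma rep_e_perm:
  assumes "w permutes {1..N}"
  shows "rep (e_perm N w) (delta id) = delta (perm_inv w)"
proof
  fix u
  obtain v where v: "v \<in> normal_words N" "word_perm v = w"
    using normal_word_exists[OF assms] by blast
  show "rep (e_perm N w) (delta id) u = delta (perm_inv w) u"
    using rep_idc_cong[OF e_perm_cong_normal_word[OF v(1)], of "delta id" u] v(2)
    by (simp add: rep_wd wop_normal_word[OF v(1)])
qed

lemma e_perm_in_free_alg:
  assumes "w permutes {1..N}"
  shows "e_perm N w \<in> carrier (free_alg N)"
proof -
  obtain ks where ks: "reduced_word N w ks" "e_perm N w = wd ks"
    using e_perm_reduced[OF assms] by blast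
  then have "set ks \<subseteq> {1..<N}"
    unfolding reduced_word_def is_arg_min_def by blast
  then show ?thesis
    unfolding ks(2) by (rule wd_in_free_alg)
qed

lemma gen_scal_commute: "gen i * scal c = scal c * gen i"
  by (simp add: gen_def wd_scal_commute)

lemma word_cong_normal:
  assumes "set ks \<subseteq> {1..<N}"
  shows "\<exists>c. \<exists>v \<in> normal_words N. idc_cong N (wd ks) (scal c * wd v)"
  using assms
proof (induction ks)
  case Nil
  show ?case
    using Nil_in_normal_words by (intro exI[of _ 1] bexI[of _ "[]"]) (auto simp: scal_1 idc_cong_refl)
next
  case (Cons i ks)
  then obtain c v where v: "v \<in> normal_words N" "idc_cong N (wd ks) (scal c * wd v)"
    by auto
  have "idc_cong N (gen i * wd ks) (gen i * (scal c * wd v))"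
    using Cons.prems v(2) by (intro idc_cong_lmult gen_in_free_alg) auto
  also have "gen i * (scal c * wd v) = scal c * wd (i # v)"
    by (simp only: wd_Cons mult.assoc[symmetric] gen_scal_commute)
  finally have iv: "idc_cong N (wd (i # ks)) (scal c * wd (i # v))"
    by (simp add: wd_Cons)
  have "\<exists>d. \<exists>v' \<in> normal_words N. idc_cong N (wd (i # v)) (scal d * wd v')"
  proof -
    have i: "i \<in> {1..<N}"
      using Cons.prems by simp
    from gen_times_normal_word[OF v(1) i order_refl] show ?thesis
    proof (elim disjE bexE conjE)
      fix v' assume "v' \<in> normal_words N" "braid_equiv N (i # v) v'"
      then show ?thesis
        by (intro exI[of _ 1] bexI[of _ v']) (auto simp: braid_equiv_def scal_1)
    qed (use v(1) in blast)
  qed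
  then obtain d v' where v': "v' \<in> normal_words N" "idc_cong N (wd (i # v)) (scal d * wd v')"
    by blast
  have "idc_cong N (wd (i # ks)) (scal (c * d) * wd v')"
    using idc_cong_trans[OF iv idc_cong_lmult[OF scal_in_free_alg v'(2)]]
    by (simp add: scal_mult mult.assoc)
  with v'(1) show ?case by blast
qed

lemma expansion_exists:
  assumes f: "f \<in> carrier (free_alg N)"
  shows "\<exists>c. idc_cong N f (\<Sum>w | w permutes {1..N}. scal (c w) * e_perm N w)"
proof -
  let ?S = "{w. w permutes {1..N}}"
  have fin: "finite ?S" by (rule finite_permutations) simp
  have word: "\<exists>c. idc_cong N (wd (letters k)) (\<Sum>w\<in>?S. scal (c w) * e_perm N w)"
    if "k \<in> Poly_Mapping.keys f" for k
  proof -
    have "set (letters k) \<subseteq> {1..<N}"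
      using f that by (simp add: carrier_free_alg)
    then obtain c v where v: "v \<in> normal_words N" "idc_cong N (wd (letters k)) (scal c * wd v)"
      using word_cong_normal by blast
    have cong: "idc_cong N (wd (letters k)) (scal c * e_perm N (word_perm v))"
      using idc_cong_trans[OF v(2) idc_cong_lmult[OF scal_in_free_alg
            idc_cong_sym[OF e_perm_cong_normal_word[OF v(1)]]]] .
    have "word_perm v \<in> ?S"
      using word_perm_permutes[OF normal_words_letters[OF v(1)]] by blast
    have "(\<Sum>w\<in>?S. scal (if w = word_perm v then c else 0) * e_perm N w)
        = (\<Sum>w\<in>?S. if w = word_perm v then scal c * e_perm N w else 0)"
      by (rule sum.cong) (auto simp: scal_0)
    also have "\<dots> = scal c * e_perm N (word_perm v)"
      using fin \<open>word_perm v \<in> ?S\<close> by (simp only: sum.delta if_True)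
    finally show ?thesis
      using cong by (intro exI[of _ "\<lambda>w. if w = word_perm v then c else 0"]) (simp only:)
  qed
  then have "\<exists>c. \<forall>k\<in>Poly_Mapping.keys f.
      idc_cong N (wd (letters k)) (\<Sum>w\<in>?S. scal (c k w) * e_perm N w)"
    by (intro bchoice) (rule ballI)
  then obtain c where c: "\<And>k. k \<in> Poly_Mapping.keys f \<Longrightarrow>
      idc_cong N (wd (letters k)) (\<Sum>w\<in>?S. scal (c k w) * e_perm N w)"
    by blast
  let ?K = "Poly_Mapping.keys f" and ?l = "Poly_Mapping.lookup f"
  have "f = (\<Sum>k\<in>?K. scal (?l k) * wd (letters k))"
    by (subst (1) poly_mapping_sum_singles[of f]) (simp add: single_eq_scal_wd)
  also have "idc_cong N \<dots> (\<Sum>k\<in>?K. scal (?l k) * (\<Sum>w\<in>?S. scal (c k w) * e_perm N w))"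
    by (intro idc_cong_sum idc_cong_lmult c) auto
  also have "\<dots> = (\<Sum>w\<in>?S. scal (\<Sum>k\<in>?K. ?l k * c k w) * e_perm N w)"
    by (simp add: scal_sum scal_mult sum_distrib_left sum_distrib_right mult.assoc)
       (rule sum.swap)
  finally show ?thesis
    by (rule exI[of _ "\<lambda>w. \<Sum>k\<in>?K. ?l k * c k w"])
qed

lemma expansion_coeff:
  assumes "idc_cong N f (\<Sum>w | w permutes {1..N}. scal (c w) * e_perm N w)" "w permutes {1..N}"
  shows "c w = rep f (delta id) (perm_inv w)"
proof -
  let ?S = "{w. w permutes {1..N}}"
  have fin: "finite ?S" by (rule finite_permutations) simp
  have "rep f (delta id) (perm_inv w) = (\<Sum>v\<in>?S. c v * delta (perm_inv v) (perm_inv w))"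
    unfolding rep_idc_cong[OF assms(1)]
    by (simp add: rep_sum rep_mult rep_scal) (rule sum.cong; simp add: rep_e_perm)
  also have "\<dots> = (\<Sum>v\<in>?S. if v = w then c v else 0)"
  proof (rule sum.cong)
    fix v assume "v \<in> ?S"
    then have "perm_inv w = perm_inv v \<longleftrightarrow> w = v"
      using assms(2) by (metis mem_Collect_eq permutes_inv_inv)
    then show "c v * delta (perm_inv v) (perm_inv w) = (if v = w then c v else 0)"
      by (auto simp: delta_def)
  qed simp
  also have "\<dots> = c w"
    using fin assms(2) by simp
  finally show ?thesis by simp
qed

text \<open>
  The classes of the \<open>e\<^sub>w\<close> span \<^term>\<open>IdC N\<close>, as every word reduces to a multiple of a normal word. They are
  independent since their operators send the basis vector of the identity to distinct basis
  vectors. Hence coefficients can be read off from the representation.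
\<close>

theorem idc_coeff_eq_rep:
  assumes f: "f \<in> carrier (free_alg N)" and w: "w permutes {1..N}"
  shows "idc_coeff N (idc_class N f) w = rep f (delta id) (perm_inv w)"
proof -
  let ?S = "{w. w permutes {1..N}}"
  define c where "c = (\<lambda>w. if w permutes {1..N} then rep f (delta id) (perm_inv w) else 0)"
  have carr: "(\<Sum>w\<in>?S. scal (d w) * e_perm N w) \<in> carrier (free_alg N)" for d
    by (intro sum_in_free_alg mult_in_free_alg e_perm_in_free_alg) auto
  have "idc_coeff N (idc_class N f) = c"
    unfolding idc_coeff_def
  proof (rule the_equality)
    obtain d where d: "idc_cong N f (\<Sum>w\<in>?S. scal (d w) * e_perm N w)"
      using expansion_exists[OF f] by blast
    have "(\<Sum>w\<in>?S. scal (d w) * e_perm N w) = (\<Sum>w\<in>?S. scal (c w) * e_perm N w)"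
      by (rule sum.cong) (auto simp: c_def expansion_coeff[OF d])
    with d have "idc_class N f = idc_class N (\<Sum>w\<in>?S. scal (c w) * e_perm N w)"
      using idc_class_eq_iff[OF f carr[of c]] by (simp only:)
    then show "(\<forall>w. \<not> w permutes {1..N} \<longrightarrow> c w = 0)
        \<and> idc_class N f = idc_class N (\<Sum>w\<in>?S. scal (c w) * e_perm N w)"
      by (auto simp: c_def)
  next
    fix d assume d: "(\<forall>w. \<not> w permutes {1..N} \<longrightarrow> d w = 0)
        \<and> idc_class N f = idc_class N (\<Sum>w\<in>?S. scal (d w) * e_perm N w)"
    then have "idc_cong N f (\<Sum>w\<in>?S. scal (d w) * e_perm N w)"
      using idc_class_eq_iff[OF f carr[of d]] by blast
    then have "d w = c w" if "w permutes {1..N}" for w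
      unfolding c_def using that expansion_coeff by (simp only: if_True)
    with d show "d = c"
      unfolding c_def by (intro ext) metis
  qed
  with w show ?thesis by (simp add: c_def)
qed

section \<open>Grassmannian permutations\<close>

text \<open>
  Permutations in \<open>S\<^sub>N\<close> without a descent outside \<open>n\<close>. The values \<open>w 1 < \<cdots> < w n\<close> are regarded as the
  positions of \<open>n\<close> particles on the sites \<open>1, \<dots>, N\<close>, and they determine \<open>w\<close>.
\<close>

definition grassmannian :: "nat \<Rightarrow> nat \<Rightarrow> (nat \<Rightarrow> nat) \<Rightarrow> bool" where
  "grassmannian N n w \<longleftrightarrow>
     w permutes {1..N} \<and> strict_mono_on {1..n} w \<and> strict_mono_on {n<..} w"

lemma grassmannian_less:
  "grassmannian N n w \<Longrightarrow> 1 \<le> i \<Longrightarrow> i < j \<Longrightarrow> j \<le> n \<Longrightarrow> w i < w j"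
  unfolding grassmannian_def strict_mono_on_def by auto

lemma grassmannian_inj: "grassmannian N n w \<Longrightarrow> w i = w j \<longleftrightarrow> i = j"
  unfolding grassmannian_def by (auto dest: permutes_inj injD)

lemma grassmannian_ge:
  assumes "grassmannian N n w" "1 \<le> l" "l \<le> n"
  shows "l \<le> w l"
  using assms(2,3)
proof (induction l rule: nat_induct_at_least)
  case base
  have "w 1 \<noteq> w 0" "w 0 = 0"
    using grassmannian_inj[OF assms(1), of 1 0] assms(1)
    by (auto simp: grassmannian_def permutes_def)
  then show ?case by simp
next
  case (Suc l)
  then have "w l < w (Suc l)"
    by (intro grassmannian_less[OF assms(1)]) auto
  with Suc show ?case by simp
qed

text \<open>
  A permutation that increases beyond \<open>n\<close> is determined by its values up to \<open>n\<close>.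
\<close>

lemma strict_mono_perms_agree:
  fixes s t :: "nat \<Rightarrow> nat"
  assumes "bij s" "bij t" "strict_mono_on {n<..} s" "strict_mono_on {n<..} t"
    and "\<And>i. i \<le> n \<Longrightarrow> s i = t i"
  shows "s = t"
proof -
  have inj: "inj s" "inj t" and surj: "surj s" "surj t"
    using assms(1,2) by (auto simp: bij_def)
  \<comment> \<open>The values below \<open>i\<close> being used up, the smallest one available to either permutation is taken at \<open>i\<close>.\<close>
  have le: "t' i \<le> s' i"
    if agree: "\<And>j. j < i \<Longrightarrow> s' j = t' j" and "n < i" and "inj s'" "surj t'" "strict_mono_on {n<..} t'"
    for s' t' :: "nat \<Rightarrow> nat" and i
  proof -
    obtain j where j: "t' j = s' i"
      using \<open>surj t'\<close> by (metis surjD)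
    have "i \<le> j"
      using agree[of j] j injD[OF \<open>inj s'\<close>, of i j] by (metis not_le order_less_irrefl)
    then have "t' i \<le> t' j"
      using that(5) \<open>n < i\<close> unfolding strict_mono_on_def by (cases "i = j") (auto intro: less_imp_le)
    with j show ?thesis by simp
  qed
  have "s i = t i" for i
  proof (induction i rule: less_induct)
    case (less i)
    show ?case
    proof (cases "i \<le> n")
      case False
      then show ?thesis
        using le[of i s t] le[of i t s] less inj surj assms(3,4) by (simp add: order_antisym)
    qed (rule assms(5))
  qed
  then show ?thesis by blast
qed

lemma transpose_Suc_mono:
  "x < y \<Longrightarrow> \<not> (x = i \<and> y = Suc i) \<Longrightarrow> transpose i (Suc i) x < transpose i (Suc i) (y::nat)"
  by (auto simp: transpose_def)

text \<open>
  At a grassmannian permutation, \<open>e\<^sub>k\<close> contributes only if site \<open>k+1\<close> is occupied and site \<open>k\<close> is empty.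
\<close>

lemma eop_stay:
  assumes w: "grassmannian N n w" and "1 \<le> k"
    and stay: "\<not> (Suc k \<in> w ` {1..n} \<and> k \<notin> w ` {1..n})"
  shows "eop k \<phi> (perm_inv w) = 0"
proof -
  have perm: "w permutes {1..N}" using w by (simp add: grassmannian_def)
  define a b where "a = perm_inv w k" and "b = perm_inv w (Suc k)"
  have ab: "w a = k" "w b = Suc k"
    using permutes_inverses(1)[OF perm] by (simp_all only: a_def b_def)
  have "w 0 = 0" using perm by (simp add: permutes_def)
  then have pos: "1 \<le> a" "1 \<le> b"
    using ab \<open>1 \<le> k\<close> by (auto simp: Suc_le_eq intro: gr0I)
  have "\<not> b < a"
  proof
    assume "b < a"
    show False
    proof (cases "a \<le> n")
      case True
      then show False
        using grassmannian_less[OF w pos(2) \<open>b < a\<close>] ab by simp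
    next
      case False
      then have "k \<notin> w ` {1..n}"
        using ab(1) grassmannian_inj[OF w] by force
      with stay ab(2) pos(2) have "n < b" by force
      then have "w b < w a"
        using w \<open>b < a\<close> by (simp add: grassmannian_def strict_mono_on_def)
      with ab show False by simp
    qed
  qed
  then show ?thesis
    by (simp add: eop_def a_def b_def)
qed

text \<open>
  In the remaining case, the particle at \<open>k+1\<close> has come from \<open>k\<close>, or it was there already and there is
  a factor \<open>\<beta>\<close>. The values of the coefficient function at grassmannian permutations thus transform among
  themselves.
\<close>

lemma eop_move:
  assumes w: "grassmannian N n w" and k: "1 \<le> k" "k < N"
    and l: "l \<in> {1..n}" "w l = Suc k" and free: "k \<notin> w ` {1..n}"
  defines "v \<equiv> transpose k (Suc k) \<circ> w"
  shows "eop k \<phi> (perm_inv w) = \<phi> (perm_inv v) + bet * \<phi> (perm_inv w)"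
    and "grassmannian N n v" and "v l = k"
    and "\<And>j. j \<in> {1..n} \<Longrightarrow> j \<noteq> l \<Longrightarrow> v j = w j"
proof -
  have perm: "w permutes {1..N}" using w by (simp add: grassmannian_def)
  define a where "a = perm_inv w k"
  have a: "w a = k"
    using permutes_inverses(1)[OF perm] by (simp only: a_def)
  have "w 0 = 0" using perm by (simp add: permutes_def)
  then have "1 \<le> a"
    using a \<open>1 \<le> k\<close> by (auto simp: Suc_le_eq intro: gr0I)
  with a free have "n < a" by force
  moreover have "perm_inv w (Suc k) = l"
    using permutes_inverses(2)[OF perm, of l] l(2) by simp
  ultimately have "perm_inv w (Suc k) < perm_inv w k"
    using l(1) by (simp add: a_def)
  moreover have "perm_inv w \<circ> transpose k (Suc k) = perm_inv v"
    unfolding v_def using permutes_bij[OF perm] by (simp add: o_inv_distrib)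
  ultimately show "eop k \<phi> (perm_inv w) = \<phi> (perm_inv v) + bet * \<phi> (perm_inv w)"
    by (simp add: eop_def)
  show "grassmannian N n v"
    unfolding grassmannian_def
  proof (intro conjI)
    show "v permutes {1..N}"
      unfolding v_def using k by (intro permutes_compose[OF perm] permutes_swap_id) auto
    show "strict_mono_on {1..n} v"
    proof (rule strict_mono_onI)
      fix i j assume "i \<in> {1..n}" "j \<in> {1..n}" "i < j"
      then show "v i < v j"
        unfolding v_def comp_apply using grassmannian_less[OF w, of i j] free
        by (intro transpose_Suc_mono) auto
    qed
    show "strict_mono_on {n<..} v"
    proof (rule strict_mono_onI)
      fix i j assume ij: "i \<in> {n<..}" "j \<in> {n<..}" "i < j"
      then have "w i < w j"
        using w by (simp add: grassmannian_def strict_mono_on_def)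
      moreover have "w j \<noteq> Suc k"
        using grassmannian_inj[OF w, of j l] l ij by auto
      ultimately show "v i < v j"
        unfolding v_def comp_apply by (intro transpose_Suc_mono) auto
    qed
  qed
  show "v l = k" using l(2) by (simp add: v_def)
  show "v j = w j" if "j \<in> {1..n}" "j \<noteq> l" for j
  proof -
    have "w j \<noteq> k" "w j \<noteq> Suc k"
      using that free l(2) grassmannian_inj[OF w, of j l] by auto
    then show ?thesis by (simp add: v_def)
  qed
qed

section \<open>The transfer operators\<close>

text \<open>
  The operator of the factor \<open>h\<^sub>k(c) = 1 + c e\<^sub>k\<close>.
\<close>

definition hop ::
  "nat \<Rightarrow> coeff_ring \<Rightarrow> ((nat \<Rightarrow> nat) \<Rightarrow> coeff_ring) \<Rightarrow> (nat \<Rightarrow> nat) \<Rightarrow> coeff_ring" where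
  "hop k c \<phi> u = \<phi> u + c * eop k \<phi> u"

text \<open>
  The operator of the \<open>m\<close>-th row \<open>h\<^bsub>N-1\<^esub>(X\<^sub>m \<oplus> Y\<^bsub>N-m\<^esub>) \<cdots> h\<^sub>m(X\<^sub>m \<oplus> Y\<^sub>1)\<close> of the generating product.
\<close>

definition rowop ::
  "nat \<Rightarrow> (nat \<Rightarrow> coeff_ring) \<Rightarrow> (nat \<Rightarrow> coeff_ring) \<Rightarrow> nat
    \<Rightarrow> ((nat \<Rightarrow> nat) \<Rightarrow> coeff_ring) \<Rightarrow> (nat \<Rightarrow> nat) \<Rightarrow> coeff_ring" where
  "rowop N X Y m = foldr (\<lambda>k. hop k (fgl bet (X m) (Y (Suc (k - m))))) (rev [m..<N])"

text \<open>
  The bialternant of the particles \<open>m, \<dots>, n\<close> in the variables \<open>X\<^sub>m, \<dots>, X\<^sub>n\<close>, with positions counted from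
  site \<open>m\<close>. Column \<open>j\<close>, counted from \<open>0\<close>, belongs to particle \<open>n - j\<close>.
\<close>

definition row_det ::
  "nat \<Rightarrow> (nat \<Rightarrow> coeff_ring) \<Rightarrow> (nat \<Rightarrow> coeff_ring) \<Rightarrow> nat \<Rightarrow> (nat \<Rightarrow> nat) \<Rightarrow> coeff_ring" where
  "row_det n X Y m w = det (mat (Suc n - m) (Suc n - m) (\<lambda>(i, j).
     fpow bet Y (X (m + i)) (w (n - j) - m) * (1 + bet * X (m + i)) ^ j))"

text \<open>
  The intermediate matrix when the factors \<open>h\<^sub>m, \<dots>, h\<^bsub>k-1\<^esub>\<close> of row \<open>m\<close> have been applied: the columns of the
  particles at sites up to \<open>k\<close> are branching sums already, the others still belong to the bialternant
  of stage \<open>m + 1\<close>.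
\<close>

definition mixed_mat ::
  "nat \<Rightarrow> (nat \<Rightarrow> coeff_ring) \<Rightarrow> (nat \<Rightarrow> coeff_ring) \<Rightarrow> nat \<Rightarrow> nat \<Rightarrow> (nat \<Rightarrow> nat)
    \<Rightarrow> coeff_ring mat" where
  "mixed_mat n X Y m k w = mat (n - m) (n - m) (\<lambda>(i, j).
     (if w (n - j) \<le> k
      then branch_sum bet Y (X m) (X (Suc (m + i))) (w (n - Suc j) - m) (w (n - j) - m)
      else fpow bet Y (X (Suc (m + i))) (w (n - j) - Suc m)) * (1 + bet * X (Suc (m + i))) ^ j)"

text \<open>
  The Vandermonde product of \<open>X\<^sub>m, \<dots>, X\<^sub>n\<close>.
\<close>

abbreviation (input) vprod :: "nat \<Rightarrow> (nat \<Rightarrow> coeff_ring) \<Rightarrow> nat \<Rightarrow> coeff_ring" where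
  "vprod n X m \<equiv> (\<Prod>(i, j) \<in> {(i, j). m \<le> i \<and> i < j \<and> j \<le> n}. X i - X j)"

text \<open>
  The effect of the first factors of row \<open>m\<close>, by induction on their number. One more factor \<open>h\<^sub>k\<close> matters
  only if a particle sits at \<open>k+1\<close> with \<open>k\<close> empty. If it is particle \<open>m\<close>, the factor contributes to the
  scalar in front of the determinant; if it is a later one, a single column changes, and the
  recursion of the branching sum together with linearity in that column gives the claim.
\<close>

lemma partial_row:
  assumes m: "1 \<le> m" "m \<le> n" and mk: "m \<le> k" "k \<le> N"
    and phi: "\<And>w. grassmannian N n w \<Longrightarrow> vprod n X (Suc m) * \<phi> (perm_inv w)
        = (if \<forall>i \<in> {1..<Suc m}. w i = i then row_det n X Y (Suc m) w else 0)"
    and w: "grassmannian N n w"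
  shows "vprod n X (Suc m)
      * foldr (\<lambda>k. hop k (fgl bet (X m) (Y (Suc (k - m))))) (rev [m..<k]) \<phi> (perm_inv w)
    = (if (\<forall>i \<in> {1..<m}. w i = i) \<and> w m \<le> k
       then fpow bet Y (X m) (w m - m) * det (mixed_mat n X Y m k w) else 0)"
  using mk w
proof (induction k arbitrary: w rule: nat_induct_at_least)
  case base
  note w = base.prems(2)
  have ge: "m \<le> w m"
    by (rule grassmannian_ge[OF w m])
  have iff: "(\<forall>i \<in> {1..<Suc m}. w i = i) \<longleftrightarrow> (\<forall>i \<in> {1..<m}. w i = i) \<and> w m \<le> m"
    using ge m by (auto simp: less_Suc_eq)
  have "row_det n X Y (Suc m) w = fpow bet Y (X m) (w m - m) * det (mixed_mat n X Y m m w)"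
    if "w m \<le> m"
  proof -
    have "m < w (n - j)" if "j < n - m" for j
    proof -
      have "m < n - j" using that by arith
      then have "w m < w (n - j)"
        using m by (intro grassmannian_less[OF w]) auto
      with ge show ?thesis by simp
    qed
    then have "mat (n - m) (n - m) (\<lambda>(i, j). fpow bet Y (X (Suc m + i)) (w (n - j) - Suc m)
          * (1 + bet * X (Suc m + i)) ^ j) = mixed_mat n X Y m m w"
      unfolding mixed_mat_def by (intro eq_matI) (auto simp: not_le[symmetric])
    then show ?thesis
      using that by (simp add: row_det_def)
  qed
  then show ?case
    using phi[OF w] iff by simp
next
  case (Suc k)
  note w = Suc.prems(2)
  define r where "r = fgl bet (X m) (Y (Suc (k - m)))"
  let ?V = "vprod n X (Suc m)"
  let ?\<psi> = "\<lambda>k. foldr (\<lambda>k. hop k (fgl bet (X m) (Y (Suc (k - m))))) (rev [m..<k]) \<phi>"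
  let ?fix = "\<lambda>w. \<forall>i \<in> {1..<m}. w i = i"
  have IH: "?V * ?\<psi> k (perm_inv u) = (if ?fix u \<and> u m \<le> k
      then fpow bet Y (X m) (u m - m) * det (mixed_mat n X Y m k u) else 0)"
    if "grassmannian N n u" for u
    using Suc.IH that Suc.prems(1) by simp
  have step: "?\<psi> (Suc k) (perm_inv w) = ?\<psi> k (perm_inv w) + r * eop k (?\<psi> k) (perm_inv w)"
    using Suc.hyps by (simp add: hop_def r_def)
  have k: "1 \<le> k" "k < N"
    using Suc.hyps Suc.prems m by simp_all
  have km: "Suc k - m = Suc (k - m)"
    using Suc.hyps by simp
  show ?case
  proof (cases "Suc k \<in> w ` {1..n} \<and> k \<notin> w ` {1..n}")
    case False
    have "?\<psi> (Suc k) (perm_inv w) = ?\<psi> k (perm_inv w)"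
      unfolding step eop_stay[OF w k(1) False] by simp
    moreover have prev: "w (l - 1) = k \<and> 1 < l" if "l \<in> {1..n}" "w l = Suc k" for l
    proof -
      from False that obtain l' where l': "l' \<in> {1..n}" "w l' = k" by force
      have "l' < l"
        using grassmannian_less[OF w, of l l'] that l' by (cases l l' rule: linorder_cases) auto
      moreover have "\<not> l' < l - 1"
      proof
        assume "l' < l - 1"
        moreover have "1 \<le> l'" "l \<le> n" using that l' by auto
        ultimately have "w l' < w (l - 1)" "w (l - 1) < w l"
          by (intro grassmannian_less[OF w]; arith)+
        with that l' show False by simp
      qed
      ultimately have "l' = l - 1" by simp
      with l' show ?thesis by auto
    qed
    moreover have "w m \<le> Suc k \<longleftrightarrow> w m \<le> k" if "?fix w"
    proof -
      have "w m \<noteq> Suc k"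
      proof
        assume "w m = Suc k"
        with prev[of m] m have "w (m - 1) = k" "1 < m" by auto
        with \<open>?fix w\<close> have "m - 1 = k" by auto
        with Suc.hyps \<open>1 < m\<close> show False by simp
      qed
      then show ?thesis by auto
    qed
    moreover have same: "branch_sum bet Y (X m) x (w (n - Suc j) - m) (w (n - j) - m)
        = fpow bet Y x (w (n - j) - Suc m)"
      if "j < n - m" "w (n - j) \<le> Suc k" "\<not> w (n - j) \<le> k" for x j
    proof -
      have "w (n - j) = Suc k" using that by simp
      moreover from this have "w (n - Suc j) = k"
        using prev[of "n - j"] that(1) by simp
      ultimately show ?thesis by (simp add: km)
    qed
    then have "mixed_mat n X Y m (Suc k) w = mixed_mat n X Y m k w"
      unfolding mixed_mat_def by (intro eq_matI) auto
    ultimately show ?thesis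
      using IH[OF w] by auto
  next
    case True
    then obtain l where l: "l \<in> {1..n}" "w l = Suc k" and free: "k \<notin> w ` {1..n}" by force
    define v where "v = transpose k (Suc k) \<circ> w"
    note move = eop_move[OF w k l free, folded v_def]
    have ne: "w j \<noteq> k" if "j \<in> {1..n}" for j
      using free that by auto
    have ne': "w j \<noteq> Suc k" if "j \<noteq> l" for j
      using grassmannian_inj[OF w, of j l] that l(2) by auto
    have above: "Suc k < w j" if "l < j" "j \<le> n" for j
      using grassmannian_less[OF w, of l j] l that by simp
    have val: "?V * ?\<psi> (Suc k) (perm_inv w)
        = (1 + bet * r) * (?V * ?\<psi> k (perm_inv w)) + r * (?V * ?\<psi> k (perm_inv v))"
      unfolding step move(1) by (simp add: algebra_simps)
    consider "l < m" | "l = m" | "m < l" by linarith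
    then show ?thesis
    proof cases
      case 1
      \<comment> \<open>A particle before \<open>m\<close> is displaced before and after the move, so both sides vanish.\<close>
      then have moved: "\<not> ?fix w" "\<not> ?fix v"
        using l move(3) Suc.hyps by (auto intro!: bexI[of _ l])
      then have "?V * ?\<psi> k (perm_inv w) = 0" "?V * ?\<psi> k (perm_inv v) = 0"
        using IH[OF w] IH[OF move(2)] by (simp_all only: simp_thms if_False)
      with moved show ?thesis
        by (simp only: val mult_zero_right add_0_right simp_thms if_False)
    next
      case 2
      \<comment> \<open>Only the configuration before the move counts, and its scalar gains the factor \<open>r\<close>.\<close>
      have fix_v: "?fix v \<longleftrightarrow> ?fix w"
        using move(4) m 2 by auto
      have unchanged: "v (n - j) = w (n - j) \<and> \<not> w (n - j) \<le> k \<and> \<not> w (n - j) \<le> Suc k"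
        if "j < n - m" for j
      proof -
        have "l < n - j" using 2 that by arith
        then show ?thesis
          using above[of "n - j"] move(4)[of "n - j"] by simp
      qed
      have "mixed_mat n X Y m k v = mixed_mat n X Y m (Suc k) w"
        unfolding mixed_mat_def
        by (intro eq_matI) (simp_all add: unchanged)
      then show ?thesis
        unfolding val IH[OF w] IH[OF move(2)] fix_v
        using 2 l move(3) by (simp add: km fpow_Suc r_def)
    next
      case 3
      have fix_v: "?fix v \<longleftrightarrow> ?fix w" and vm: "v m = w m"
        using move(4) m 3 by auto
      have wm: "w m \<le> Suc k \<longleftrightarrow> w m \<le> k"
        using ne'[of m] 3 by (auto simp: le_Suc_eq)
      have prev: "v (l - 1) = w (l - 1)" "w (l - 1) - m < k - m"
      proof -
        have l': "1 \<le> l - 1" "l - 1 \<le> n" "l - 1 < l"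
          using l m 3 by auto
        then have "w (l - 1) < Suc k" "w (l - 1) \<noteq> k" "l - 1 \<le> w (l - 1)"
          using grassmannian_less[OF w l'(1,3)] ne[of "l - 1"] grassmannian_ge[OF w l'(1,2)] l by auto
        then show "w (l - 1) - m < k - m"
          using 3 by simp
        show "v (l - 1) = w (l - 1)"
          using move(4)[of "l - 1"] l' by auto
      qed
      \<comment> \<open>The column of the particle that moves.\<close>
      define j0 where "j0 = n - l"
      have j0: "j0 < n - m" "n - j0 = l" "n - Suc j0 = l - 1"
        using 3 l by (auto simp: j0_def)
      have "det (mixed_mat n X Y m (Suc k) w)
          = r * det (mixed_mat n X Y m k v) + (1 + bet * r) * det (mixed_mat n X Y m k w)"
      proof (rule det_column_linear[OF _ _ _ j0(1)])
        fix i assume i: "i < n - m"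
        let ?z = "X (Suc (m + i))"
        have "branch_sum bet Y (X m) ?z (w (l - 1) - m) (Suc (k - m))
            = r * branch_sum bet Y (X m) ?z (w (l - 1) - m) (k - m) + (1 + bet * r) * fpow bet Y ?z (k - m)"
          using prev(2) by (simp add: r_def)
        then show "mixed_mat n X Y m (Suc k) w $$ (i, j0)
            = r * mixed_mat n X Y m k v $$ (i, j0) + (1 + bet * r) * mixed_mat n X Y m k w $$ (i, j0)"
          using i j0 l move(3) prev(1) by (simp add: mixed_mat_def km algebra_simps)
      next
        fix i j assume ij: "i < n - m" "j < n - m" "j \<noteq> j0"
        have nj: "n - j \<noteq> l" "n - j \<in> {1..n}"
          using ij j0 by auto
        then have eq: "v (n - j) = w (n - j)" "w (n - j) \<le> Suc k \<longleftrightarrow> w (n - j) \<le> k"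
          using move(4)[of "n - j"] ne'[of "n - j"] by (auto simp: le_Suc_eq)
        have "v (n - Suc j) = w (n - Suc j)" if "w (n - j) \<le> k"
        proof -
          have "n - Suc j \<noteq> l"
          proof
            assume "n - Suc j = l"
            then have "l < n - j" using ij by simp
            with above[of "n - j"] that show False by simp
          qed
          then show ?thesis
            using move(4)[of "n - Suc j"] ij m by simp
        qed
        with eq ij show "mixed_mat n X Y m k v $$ (i, j) = mixed_mat n X Y m (Suc k) w $$ (i, j)
            \<and> mixed_mat n X Y m k w $$ (i, j) = mixed_mat n X Y m (Suc k) w $$ (i, j)"
          by (simp add: mixed_mat_def)
      qed (simp_all add: mixed_mat_def)
      then show ?thesis
        unfolding val IH[OF w] IH[OF move(2)] fix_v vm wm
        by (simp add: algebra_simps)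
    qed
  qed
qed

lemma rowop_step:
  assumes m: "1 \<le> m" "m \<le> n" and nN: "n \<le> N"
    and nz: "1 + bet * X m \<noteq> 0"
    and phi: "\<And>w. grassmannian N n w \<Longrightarrow> vprod n X (Suc m) * \<phi> (perm_inv w)
        = (if \<forall>i \<in> {1..<Suc m}. w i = i then row_det n X Y (Suc m) w else 0)"
    and w: "grassmannian N n w"
  shows "vprod n X m * rowop N X Y m \<phi> (perm_inv w)
        = (if \<forall>i \<in> {1..<m}. w i = i then row_det n X Y m w else 0)"
proof -
  have le_N: "w l \<le> N" if "l \<in> {1..n}" for l
    using w that nN permutes_in_image[of w "{1..N}" l] by (auto simp: grassmannian_def)
  have dims: "Suc n - m = Suc (n - m)" using m by simp
  define S where "S = mat (n - m) (n - m) (\<lambda>(i, j).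
      branch_sum bet Y (X (m + 0)) (X (m + Suc i)) (w (n - Suc j) - m) (w (n - j) - m)
      * (1 + bet * X (m + Suc i)) ^ j)"
  have "mixed_mat n X Y m N w = S"
    unfolding mixed_mat_def S_def by (intro eq_matI) (auto simp: le_N)
  moreover have "row_det n X Y m w = (\<Prod>i<n - m. X (m + 0) - X (m + Suc i))
      * fpow bet Y (X (m + 0)) (w (n - (n - m)) - m) * det S"
    unfolding row_det_def dims S_def
  proof (rule branching_det[where x = "\<lambda>i. X (m + i)" and c = "\<lambda>j. w (n - j) - m"])
    fix j assume "j < n - m"
    then have "m \<le> n - Suc j" "n - Suc j < n - j"
      by arith+
    then show "w (n - Suc j) - m < w (n - j) - m"
      using grassmannian_less[OF w, of "n - Suc j" "n - j"] grassmannian_ge[OF w, of "n - Suc j"] m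
      by (intro diff_less_mono) auto
  qed (use nz in simp)
  moreover have "(\<Prod>i<n - m. X (m + 0) - X (m + Suc i)) = (\<Prod>j = Suc m..n. X m - X j)"
    by (rule prod.reindex_bij_witness[of _ "\<lambda>j. j - Suc m" "\<lambda>i. m + Suc i"]) (use m in auto)
  ultimately have "row_det n X Y m w
      = (\<Prod>j = Suc m..n. X m - X j) * (fpow bet Y (X m) (w m - m) * det (mixed_mat n X Y m N w))"
    using m by (simp add: mult.assoc)
  moreover have "w m \<le> N"
    using le_N m by simp
  moreover have "m \<le> N"
    using m nN by simp
  ultimately show ?thesis
    using partial_row[OF m \<open>m \<le> N\<close> order_refl phi w] prod_pairs_split[OF m(2), of "\<lambda>i j. X i - X j"]
    by (simp add: rowop_def mult.assoc)
qed

text \<open>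
  Applied to the basis vector of the identity, a row beyond \<open>n\<close> does not change the coefficients at
  grassmannian permutations: the particles occupy the sites \<open>1, \<dots>, n\<close>, and none of the factors moves
  them.
\<close>

lemma rowop_trivial:
  assumes "n < m"
    and phi: "\<And>w. grassmannian N n w \<Longrightarrow> \<phi> (perm_inv w) = (if \<forall>i \<in> {1..n}. w i = i then 1 else 0)"
    and w: "grassmannian N n w"
  shows "rowop N X Y m \<phi> (perm_inv w) = (if \<forall>i \<in> {1..n}. w i = i then 1 else 0)"
proof -
  have "foldr (\<lambda>k. hop k (c k)) (rev [m..<k]) \<phi> (perm_inv w) = (if \<forall>i \<in> {1..n}. w i = i then 1 else 0)"
    if "k \<le> N" for c k
    using that w
  proof (induction k arbitrary: w)
    case (Suc k)
    note w = Suc.prems(2)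
    let ?\<psi> = "foldr (\<lambda>k. hop k (c k)) (rev [m..<k]) \<phi>"
    have IH: "?\<psi> (perm_inv u) = (if \<forall>i \<in> {1..n}. u i = i then 1 else 0)" if "grassmannian N n u" for u
      using Suc.IH Suc.prems(1) that by simp
    show ?case
    proof (cases "m \<le> k")
      case True
      have "eop k ?\<psi> (perm_inv w) = 0"
      proof (cases "Suc k \<in> w ` {1..n} \<and> k \<notin> w ` {1..n}")
        case False
        then show ?thesis
          using True \<open>n < m\<close> by (intro eop_stay[OF w]) auto
      next
        case True
        then obtain l where l: "l \<in> {1..n}" "w l = Suc k" and free: "k \<notin> w ` {1..n}" by force
        have k: "1 \<le> k" "k < N"
          using \<open>m \<le> k\<close> \<open>n < m\<close> Suc.prems(1) by auto
        note move = eop_move[OF w k l free]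
        have "w l \<noteq> l" "(transpose k (Suc k) \<circ> w) l \<noteq> l"
          using l move(3) \<open>m \<le> k\<close> \<open>n < m\<close> by auto
        then show ?thesis
          unfolding move(1) IH[OF w] IH[OF move(2)] using l(1) by auto
      qed
      moreover have "foldr (\<lambda>k. hop k (c k)) (rev [m..<Suc k]) \<phi> (perm_inv w)
          = ?\<psi> (perm_inv w) + c k * eop k ?\<psi> (perm_inv w)"
        using True by (simp add: hop_def)
      ultimately show ?thesis
        using IH[OF w] by simp
    next
      case False
      then show ?thesis using phi[OF w] by simp
    qed
  qed (simp add: phi)
  then show ?thesis
    unfolding rowop_def by (cases "m \<le> N") (simp_all add: phi w)
qed

text \<open>
  The rows act from the last to the first; row \<open>m \<le> n\<close> releases particle \<open>m\<close>.
\<close>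

theorem grassmannian_transfer:
  assumes nz: "\<And>i. 1 + bet * X i \<noteq> 0" and nN: "n \<le> N" and w: "grassmannian N n w"
  shows "vprod n X 1 * foldr (rowop N X Y) [1..<N] (delta id) (perm_inv w) = row_det n X Y 1 w"
proof -
  let ?C = "\<lambda>m. foldr (rowop N X Y) [m..<N] (delta id)"
  have C_Suc: "?C m = rowop N X Y m (?C (Suc m))" for m
    by (cases "m < N") (simp_all add: upt_conv_Cons rowop_def)
  have trivial: "foldr (rowop N X Y) ms (delta id) (perm_inv w) = (if \<forall>i \<in> {1..n}. w i = i then 1 else 0)"
    if "\<forall>m \<in> set ms. n < m" "grassmannian N n w" for ms w
    using that
  proof (induction ms arbitrary: w)
    case Nil
    then have perm: "w permutes {1..N}" and mono: "strict_mono_on {n<..} w"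
      by (auto simp: grassmannian_def)
    have "perm_inv w = id \<longleftrightarrow> w = id"
      using permutes_inv_inv[OF perm] by auto
    also have "\<dots> \<longleftrightarrow> (\<forall>i \<in> {1..n}. w i = i)"
    proof
      assume fixed: "\<forall>i \<in> {1..n}. w i = i"
      have "w 0 = 0" using perm by (simp add: permutes_def)
      with fixed have "w i = id i" if "i \<le> n" for i
        using that by (cases i) auto
      then show "w = id"
        using strict_mono_perms_agree[OF permutes_bij[OF perm] bij_id mono] by (auto simp: strict_mono_on_def)
    qed auto
    finally show "foldr (rowop N X Y) [] (delta id) (perm_inv w) = (if \<forall>i \<in> {1..n}. w i = i then 1 else 0)"
      by (simp add: delta_def)
  next
    case (Cons m ms)
    then have "n < m" by simp
    have IH: "foldr (rowop N X Y) ms (delta id) (perm_inv u) = (if \<forall>i \<in> {1..n}. u i = i then 1 else 0)"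
      if "grassmannian N n u" for u
      by (rule Cons.IH[OF _ that]) (use Cons.prems in auto)
    show "foldr (rowop N X Y) (m # ms) (delta id) (perm_inv w) = (if \<forall>i \<in> {1..n}. w i = i then 1 else 0)"
      unfolding foldr.simps comp_apply by (rule rowop_trivial[OF \<open>n < m\<close> IH Cons.prems(2)])
  qed
  have "vprod n X m * ?C m (perm_inv w) = (if \<forall>i \<in> {1..<m}. w i = i then row_det n X Y m w else 0)"
    if "m \<le> Suc n" "1 \<le> m" "grassmannian N n w" for m w
    using that
  proof (induction m arbitrary: w rule: inc_induct)
    case base
    have "{(i, j). Suc n \<le> i \<and> i < j \<and> j \<le> n} = {}" by auto
    then have "vprod n X (Suc n) = 1" by (simp only: prod.empty)
    moreover have "?C (Suc n) (perm_inv w) = (if \<forall>i \<in> {1..n}. w i = i then 1 else 0)"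
      by (rule trivial) (use base in auto)
    ultimately show "vprod n X (Suc n) * foldr (rowop N X Y) [Suc n..<N] (delta id) (perm_inv w)
        = (if \<forall>i \<in> {1..<Suc n}. w i = i then row_det n X Y (Suc n) w else 0)"
      by (simp add: row_det_def atLeastLessThanSuc_atLeastAtMost del: upt_Suc)
  next
    case (step m)
    have IH: "vprod n X (Suc m) * ?C (Suc m) (perm_inv u)
        = (if \<forall>i \<in> {1..<Suc m}. u i = i then row_det n X Y (Suc m) u else 0)"
      if "grassmannian N n u" for u
      by (rule step.IH[OF _ that]) simp
    have "m \<le> n" using step.hyps by simp
    show ?case
      unfolding C_Suc[of m]
      by (rule rowop_step[OF step.prems(1) \<open>m \<le> n\<close> nN nz IH step.prems(2)])
  qed
  from this[of 1 w] w show ?thesis by simp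
qed

section \<open>Complete homogeneous symmetric polynomials\<close>

lemma finite_sorted_lists: "finite {ks. length ks = r \<and> sorted ks \<and> set ks \<subseteq> {1..k::nat}}"
  by (rule finite_subset[OF _ finite_lists_length_eq[of "{1..k}" r]]) auto

lemma hsym_of_nat:
  "hsym k (int r) = (\<Sum>ks | length ks = r \<and> sorted ks \<and> set ks \<subseteq> {1..k}. prod_list (map xv ks))"
  by (simp add: hsym_def)

lemma hsym_neg: "r < 0 \<Longrightarrow> hsym k r = 0"
  by (simp add: hsym_def)

lemma hsym_0: "hsym k 0 = 1"
proof -
  have "{ks. length ks = 0 \<and> sorted ks \<and> set ks \<subseteq> {1..k}} = {[]}" by auto
  then show ?thesis
    using hsym_of_nat[of k 0] by simp
qed

lemma hsym_no_variables: "hsym 0 (int (Suc r)) = 0"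
proof -
  have "{ks. length ks = Suc r \<and> sorted ks \<and> set ks \<subseteq> {1..0::nat}} = {}" by auto
  then show ?thesis
    unfolding hsym_of_nat by (simp only: sum.empty)
qed

lemma hsym_Suc:
  "hsym (Suc k) (int (Suc r)) = hsym k (int (Suc r)) + xv (Suc k) * hsym (Suc k) (int r)"
proof -
  let ?A = "\<lambda>k r. {ks. length ks = r \<and> sorted ks \<and> set ks \<subseteq> {1..k}}"
  let ?f = "\<lambda>ks. ks @ [Suc k]"
  have "?A (Suc k) (Suc r) = ?A k (Suc r) \<union> ?f ` ?A (Suc k) r"
  proof (intro equalityI subsetI)
    fix ks assume ks: "ks \<in> ?A (Suc k) (Suc r)"
    then have ne: "ks \<noteq> []" by auto
    define us u where "us = butlast ks" and "u = last ks"
    have eq: "ks = us @ [u]" using ne by (simp add: us_def u_def)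
    show "ks \<in> ?A k (Suc r) \<union> ?f ` ?A (Suc k) r"
    proof (cases "u = Suc k")
      case True
      then show ?thesis using ks eq by (auto simp: sorted_append)
    next
      case False
      then have "set ks \<subseteq> {1..k}"
        using ks eq by (fastforce simp: sorted_append)
      then show ?thesis using ks by simp
    qed
  next
    fix ks assume "ks \<in> ?A k (Suc r) \<union> ?f ` ?A (Suc k) r"
    then show "ks \<in> ?A (Suc k) (Suc r)"
      by (fastforce simp: sorted_append)
  qed
  moreover have "?A k (Suc r) \<inter> ?f ` ?A (Suc k) r = {}" by auto
  ultimately have "hsym (Suc k) (int (Suc r))
      = hsym k (int (Suc r)) + (\<Sum>ks \<in> ?f ` ?A (Suc k) r. prod_list (map xv ks))"
    unfolding hsym_of_nat
    by (simp only:) (rule sum.union_disjoint; use finite_sorted_lists in blast)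
  also have "(\<Sum>ks \<in> ?f ` ?A (Suc k) r. prod_list (map xv ks)) = xv (Suc k) * hsym (Suc k) (int r)"
    unfolding hsym_of_nat sum_distrib_left
    by (subst sum.reindex) (auto simp: inj_on_def mult.commute)
  finally show ?thesis .
qed

text \<open>
  The factor \<open>1 - x\<^sub>l t\<close>.
\<close>

definition linear_fps :: "nat \<Rightarrow> coeff_ring fps" where
  "linear_fps l = 1 - fps_const (xv l) * fps_X"

lemma nth_0_linear_fps [simp]: "fps_nth (linear_fps l) 0 = 1"
  by (simp add: linear_fps_def)

lemma nth_times_linear_fps:
  "fps_nth (f * linear_fps l) r = fps_nth f r - (if r = 0 then 0 else xv l * fps_nth f (r - 1))"
proof -
  have "f * linear_fps l = f - fps_const (xv l) * (f * fps_X)"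
    by (simp add: linear_fps_def algebra_simps)
  then show ?thesis by simp
qed

lemma hsym_generating_function:
  "Abs_fps (\<lambda>r. hsym n (int r)) * (\<Prod>l = 1..n. linear_fps l) = 1"
proof (induction n)
  case 0
  have "Abs_fps (\<lambda>r. hsym 0 (int r)) = 1"
    by (rule fps_ext) (metis fps_nth_Abs_fps fps_one_nth hsym_0 hsym_no_variables nat.exhaust of_nat_0)
  then show ?case by simp
next
  case (Suc n)
  have "Abs_fps (\<lambda>r. hsym (Suc n) (int r)) * linear_fps (Suc n) = Abs_fps (\<lambda>r. hsym n (int r))"
  proof (rule fps_ext)
    fix r
    show "fps_nth (Abs_fps (\<lambda>r. hsym (Suc n) (int r)) * linear_fps (Suc n)) r = fps_nth (Abs_fps (\<lambda>r. hsym n (int r))) r"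
    proof (cases r)
      case 0
      then show ?thesis by (simp add: nth_times_linear_fps hsym_0)
    next
      case (Suc r')
      then show ?thesis
        using hsym_Suc[of n r'] by (simp add: nth_times_linear_fps del: of_nat_Suc)
    qed
  qed
  then show ?case
    using Suc.IH by (simp add: mult.assoc[symmetric] mult.commute[of _ "linear_fps (Suc n)"])
qed

lemma prod_linear_fps_degree:
  assumes "finite S" "card S < r"
  shows "fps_nth (\<Prod>l\<in>S. linear_fps l) r = 0"
  using assms
proof (induction S arbitrary: r rule: finite_induct)
  case (insert l S)
  then show ?case
    by (simp add: mult.commute[of "linear_fps l"] nth_times_linear_fps)
qed simp

text \<open>
  Since \<open>\<Sum>\<^sub>r h\<^sub>r t\<^sup>r = \<Prod>\<^sub>l (1 - x\<^sub>l t)\<^sup>-\<^sup>1\<close>, the series \<open>\<Sum>\<^sub>r x\<^sub>i\<^sup>r t\<^sup>r\<close> is its product with the polynomial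
  \<open>\<Prod> (1 - x\<^sub>l t)\<close> over \<open>l \<noteq> i\<close>, of degree less than \<open>n\<close>.
\<close>

lemma power_eq_sum_hsym:
  assumes "i \<in> {1..n}"
  shows "xv i ^ r = (\<Sum>s<n. fps_nth (\<Prod>l \<in> {1..n} - {i}. linear_fps l) s * hsym n (int r - int s))"
proof -
  let ?Q = "\<Prod>l \<in> {1..n} - {i}. linear_fps l"
  let ?F = "Abs_fps (\<lambda>r. hsym n (int r))" and ?P = "Abs_fps (\<lambda>r. xv i ^ r)"
  have P: "?P * linear_fps i = 1"
  proof (rule fps_ext)
    show "fps_nth (?P * linear_fps i) r = fps_nth 1 r" for r
      by (cases r) (simp_all add: nth_times_linear_fps)
  qed
  have "?F * (linear_fps i * ?Q) = 1"
    using hsym_generating_function[of n] assms by (simp add: prod.remove)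
  then have "?P = ?P * (?F * (linear_fps i * ?Q))" by simp
  also have "\<dots> = (?P * linear_fps i) * (?Q * ?F)" by (simp only: mult_ac)
  finally have PQF: "?P = ?Q * ?F" by (simp only: P mult_1)
  have "xv i ^ r = fps_nth ?P r" by simp
  also have "\<dots> = fps_nth (?Q * ?F) r" by (simp only: PQF)
  also have "\<dots> = (\<Sum>s = 0..r. fps_nth ?Q s * fps_nth ?F (r - s))"
    by (rule fps_mult_nth)
  also have "\<dots> = (\<Sum>s \<in> {0..r} \<union> {..<n}. fps_nth ?Q s * hsym n (int r - int s))"
    by (rule sum.mono_neutral_cong_left) (auto simp: hsym_neg of_nat_diff)
  also have "\<dots> = (\<Sum>s<n. fps_nth ?Q s * hsym n (int r - int s))"
  proof (rule sum.mono_neutral_right)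
    show "\<forall>s \<in> {0..r} \<union> {..<n} - {..<n}. fps_nth ?Q s * hsym n (int r - int s) = 0"
    proof
      fix s assume "s \<in> {0..r} \<union> {..<n} - {..<n}"
      then have "card ({1..n} - {i}) < s"
        using assms by auto
      then show "fps_nth ?Q s * hsym n (int r - int s) = 0"
        by (simp add: prod_linear_fps_degree)
    qed
  qed auto
  finally show ?thesis .
qed

text \<open>
  The entry in row \<open>i\<close> and column \<open>k\<close>, counted from \<open>1\<close>, is \<open>(-1)\<^bsup>n-k\<^esup>\<close> times the elementary symmetric
  polynomial of degree \<open>n - k\<close> in the variables other than \<open>x\<^sub>i\<close>.
\<close>

definition elem_mat :: "nat \<Rightarrow> coeff_ring mat" where
  "elem_mat n = mat n n (\<lambda>(i, k). fps_nth (\<Prod>l \<in> {1..n} - {Suc i}. linear_fps l) (n - Suc k))"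

lemma power_eq_elem_mat:
  assumes "i < n"
  shows "xv (Suc i) ^ r = (\<Sum>k<n. elem_mat n $$ (i, k) * hsym n (int r - int (n - Suc k)))"
proof -
  have "xv (Suc i) ^ r = (\<Sum>s<n. fps_nth (\<Prod>l \<in> {1..n} - {Suc i}. linear_fps l) s * hsym n (int r - int s))"
    using assms by (intro power_eq_sum_hsym) auto
  also have "\<dots> = (\<Sum>k<n. fps_nth (\<Prod>l \<in> {1..n} - {Suc i}. linear_fps l) (n - Suc k) * hsym n (int r - int (n - Suc k)))"
    by (rule sum.nat_diff_reindex[symmetric])
  finally show ?thesis
    using assms by (simp add: elem_mat_def)
qed

text \<open>
  The matrix of the powers \<open>x\<^sub>i\<^bsup>n-j\<^esup>\<close> is its product with the unitriangular matrix of the \<open>h\<^bsub>k-j\<^esub>\<close>.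
\<close>

lemma det_elem_mat: "det (elem_mat n) = vprod n xv 1"
proof -
  let ?L = "mat n n (\<lambda>(k, j). hsym n (int k - int j))"
  have "mat n n (\<lambda>(i, j). xv (1 + i) ^ (n - Suc j)) = elem_mat n * ?L"
  proof (rule eq_matI)
    fix i j assume "i < dim_row (elem_mat n * ?L)" "j < dim_col (elem_mat n * ?L)"
    then have ij: "i < n" "j < n" by (simp_all add: elem_mat_def)
    have "xv (Suc i) ^ (n - Suc j) = (\<Sum>k<n. elem_mat n $$ (i, k) * hsym n (int (n - Suc j) - int (n - Suc k)))"
      by (rule power_eq_elem_mat[OF ij(1)])
    also have "\<dots> = (\<Sum>k<n. elem_mat n $$ (i, k) * hsym n (int k - int j))"
      using ij by (intro sum.cong) (auto simp: of_nat_diff)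
    finally show "mat n n (\<lambda>(i, j). xv (1 + i) ^ (n - Suc j)) $$ (i, j) = (elem_mat n * ?L) $$ (i, j)"
      using ij by (simp add: elem_mat_def scalar_prod_def atLeast0LessThan)
  qed (simp_all add: elem_mat_def)
  moreover have "det ?L = 1"
  proof -
    have "det ?L = prod_list (diag_mat ?L)"
      by (rule det_lower_triangular[of n]) (auto simp: hsym_neg)
    also have "\<dots> = 1"
      by (simp add: prod_list_diag_prod hsym_0)
    finally show ?thesis .
  qed
  ultimately have "det (elem_mat n) = det (mat n n (\<lambda>(i, j). xv (1 + i) ^ (n - Suc j)))"
    by (simp add: det_mult[of _ n] elem_mat_def)
  also have "\<dots> = vprod n xv 1"
    by (subst vandermonde_det) (simp add: less_Suc_eq_le)
  finally show ?thesis .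
qed

text \<open>
  By the binomial theorem, the matrix of the bialternant is the product of \<^const>\<open>elem_mat\<close> and the matrix of
  the \<open>h\<^sup>(\<^sup>\<beta>\<^sup>)\<close>.
\<close>

lemma jacobi_trudi_hbeta:
  "vprod n xv 1 * det (mat n n (\<lambda>(i, j). hbeta n (int (lam (j + 1)) + int (i + 1)) (j + 1)))
    = det (mat n n (\<lambda>(i, j). xv (i + 1) ^ (lam (j + 1) + n - (j + 1)) * (1 + bet * xv (i + 1)) ^ j))"
proof -
  let ?H = "mat n n (\<lambda>(i, j). hbeta n (int (lam (j + 1)) + int (i + 1)) (j + 1))"
  let ?M = "mat n n (\<lambda>(i, j). xv (i + 1) ^ (lam (j + 1) + n - (j + 1)) * (1 + bet * xv (i + 1)) ^ j)"
  have "?M = elem_mat n * ?H"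
  proof (rule eq_matI)
    fix i j assume "i < dim_row (elem_mat n * ?H)" "j < dim_col (elem_mat n * ?H)"
    then have ij: "i < n" "j < n" by (simp_all add: elem_mat_def)
    let ?x = "xv (Suc i)" and ?E = "\<lambda>k. elem_mat n $$ (i, k)"
    let ?r = "lam (Suc j) + n - Suc j"
    have "(bet * ?x + 1) ^ j = (\<Sum>a\<le>j. of_nat (j choose a) * (bet * ?x) ^ a * 1 ^ (j - a))"
      by (rule binomial_ring)
    then have "?x ^ ?r * (1 + bet * ?x) ^ j
        = ?x ^ ?r * (\<Sum>a = 0..j. of_nat (j choose a) * (bet * ?x) ^ a)"
      by (simp only: add.commute[of 1] power_one mult_1_right atLeast0AtMost)
    also have "\<dots> = (\<Sum>a = 0..j. of_nat (j choose a) * bet ^ a * ?x ^ (?r + a))"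
      unfolding sum_distrib_left
      by (intro sum.cong refl) (simp only: power_mult_distrib power_add mult_ac)
    also have "\<dots> = (\<Sum>a = 0..j. \<Sum>k<n. ?E k * (of_nat (j choose a)
        * hsym n (int (lam (Suc j)) + int (Suc k) - int (Suc j) + int a) * bet ^ a))"
    proof (rule sum.cong)
      fix a
      have "?x ^ (?r + a) = (\<Sum>k<n. ?E k * hsym n (int (?r + a) - int (n - Suc k)))"
        by (rule power_eq_elem_mat[OF ij(1)])
      also have "\<dots> = (\<Sum>k<n. ?E k * hsym n (int (lam (Suc j)) + int (Suc k) - int (Suc j) + int a))"
      proof (rule sum.cong)
        fix k assume "k \<in> {..<n}"
        then have "int (?r + a) - int (n - Suc k) = int (lam (Suc j)) + int (Suc k) - int (Suc j) + int a"
          using ij by (simp add: of_nat_diff)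
        then show "?E k * hsym n (int (?r + a) - int (n - Suc k))
            = ?E k * hsym n (int (lam (Suc j)) + int (Suc k) - int (Suc j) + int a)"
          by (simp only:)
      qed simp
      finally show "of_nat (j choose a) * bet ^ a * ?x ^ (?r + a) = (\<Sum>k<n. ?E k * (of_nat (j choose a)
          * hsym n (int (lam (Suc j)) + int (Suc k) - int (Suc j) + int a) * bet ^ a))"
        unfolding sum_distrib_left by (simp only: sum_distrib_left mult_ac)
    qed simp
    also have "\<dots> = (\<Sum>k<n. ?E k * hbeta n (int (lam (Suc j)) + int (Suc k)) (Suc j))"
      unfolding hbeta_def sum_distrib_left diff_Suc_1 by (rule sum.swap)
    finally show "?M $$ (i, j) = (elem_mat n * ?H) $$ (i, j)"
      using ij by (simp add: elem_mat_def scalar_prod_def atLeast0LessThan)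
  qed (simp_all add: elem_mat_def)
  moreover have "det (elem_mat n * ?H) = det (elem_mat n) * det ?H"
    by (rule det_mult[of _ n]) (simp_all add: elem_mat_def)
  ultimately show ?thesis
    by (simp only: det_elem_mat)
qed

section \<open>The generating products\<close>

lemma prod_list_in_free_alg:
  "(\<And>i. i \<in> set xs \<Longrightarrow> f i \<in> carrier (free_alg N)) \<Longrightarrow> prod_list (map f xs) \<in> carrier (free_alg N)"
  by (induction xs) (auto intro: mult_in_free_alg)

lemma hfac_in_free_alg: "k \<in> {1..<N} \<Longrightarrow> hfac k c \<in> carrier (free_alg N)"
  unfolding hfac_def
  by (intro add_in_free_alg mult_in_free_alg gen_in_free_alg scal_in_free_alg one_in_free_alg)

lemma rep_hfac: "rep (hfac k c) = hop k c"
  by (intro ext) (simp add: hfac_def rep_add rep_1 rep_mult rep_scal rep_gen hop_def)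

lemma rep_prod_list: "rep (prod_list (map f xs)) = foldr (\<lambda>x. rep (f x)) xs"
proof (induction xs)
  case Nil
  show ?case by (intro ext) (simp add: rep_1)
next
  case (Cons x xs)
  then show ?case by (intro ext) (simp add: rep_mult)
qed

lemma bplus_eq_fgl: "bplus = fgl bet"
  by (intro ext) (simp add: bplus_def fgl_def)

lemma groth_eq_rowops:
  assumes "w permutes {1..N}"
  shows "groth N w = foldr (rowop N xv (\<lambda>_. 0)) [1..<N] (delta id) (perm_inv w)"
proof -
  have row: "rep (Afac N i (xv i)) = rowop N xv (\<lambda>_. 0) i" for i
    by (intro ext) (simp add: Afac_def rep_prod_list rep_hfac rowop_def fgl_def)
  have "Afac N i (xv i) \<in> carrier (free_alg N)" if "1 \<le> i" for i
    unfolding Afac_def using that by (intro prod_list_in_free_alg hfac_in_free_alg) auto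
  then have "prod_list (map (\<lambda>i. Afac N i (xv i)) [1..<N]) \<in> carrier (free_alg N)"
    by (intro prod_list_in_free_alg) auto
  then show ?thesis
    unfolding groth_def using assms by (simp add: idc_coeff_eq_rep rep_prod_list row)
qed

lemma double_groth_eq_rowops:
  assumes "w permutes {1..N}"
  shows "double_groth N w = foldr (rowop N xv yv) [1..<N] (delta id) (perm_inv w)"
proof -
  let ?R = "\<lambda>i. prod_list (map (\<lambda>j. hfac (i + j - 1) (bplus (xv i) (yv j))) (rev [1..<N - i + 1]))"
  have row: "rep (?R i) = rowop N xv yv i" if i: "i \<in> set [1..<N]" for i
  proof -
    have range: "[i..<N] = map (\<lambda>j. i + j - 1) [1..<N - i + 1]"
      using i by (intro nth_equalityI) (auto simp del: upt_Suc)
    show ?thesis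
      unfolding rowop_def range rev_map rep_prod_list
    proof
      fix \<phi>
      let ?js = "rev [1..<N - i + 1]"
      show "foldr (\<lambda>j. rep (hfac (i + j - 1) (bplus (xv i) (yv j)))) ?js \<phi>
          = foldr (\<lambda>k. hop k (fgl bet (xv i) (yv (Suc (k - i))))) (map (\<lambda>j. i + j - 1) ?js) \<phi>"
        unfolding foldr_map
        by (rule foldr_cong) (auto simp: rep_hfac bplus_eq_fgl simp del: upt_Suc)
    qed
  qed
  have "?R i \<in> carrier (free_alg N)" if "i \<in> set [1..<N]" for i
    using that by (intro prod_list_in_free_alg hfac_in_free_alg) auto
  then have "prod_list (map ?R [1..<N]) \<in> carrier (free_alg N)"
    by (rule prod_list_in_free_alg)
  then have "double_groth N w = foldr (\<lambda>i. rep (?R i)) [1..<N] (delta id) (perm_inv w)"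
    unfolding double_groth_def
    by (subst idc_coeff_eq_rep[OF _ assms]) (simp_all only: rep_prod_list[of ?R])
  also have "foldr (\<lambda>i. rep (?R i)) [1..<N] (delta id) = foldr (rowop N xv yv) [1..<N] (delta id)"
    by (intro foldr_cong refl) (simp only: row)
  finally show ?thesis .
qed

text \<open>
  Existence is shown by sending \<open>n+1, \<dots>, N\<close> increasingly onto the values left over; this is where
  \<open>N \<ge> n + \<lambda>\<^sub>1\<close> is needed.
\<close>

lemma grassmannian_perm_properties:
  fixes lam :: "nat \<Rightarrow> nat"
  assumes n: "n \<ge> 1"
    and lam: "\<And>i j. 1 \<le> i \<Longrightarrow> i \<le> j \<Longrightarrow> j \<le> n \<Longrightarrow> lam j \<le> lam i"
    and N: "N \<ge> n + lam 1"
  shows "grassmannian N n (grassmannian_perm N n lam)"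
    and "\<And>i. i \<in> {1..n} \<Longrightarrow> grassmannian_perm N n lam i = i + lam (n + 1 - i)"
proof -
  let ?P = "\<lambda>s. s permutes {1..N} \<and> (\<forall>i \<in> {1..n}. s i = i + lam (n + 1 - i)) \<and> strict_mono_on {n<..} s"
  define q where "q i = i + lam (n + 1 - i)" for i
  have q_mono: "strict_mono_on {1..n} q"
  proof (rule strict_mono_onI)
    fix i j assume "i \<in> {1..n}" "j \<in> {1..n}" "i < j"
    then have "lam (n + 1 - i) \<le> lam (n + 1 - j)" by (intro lam) auto
    with \<open>i < j\<close> show "q i < q j" by (simp add: q_def)
  qed
  have q_range: "q ` {1..n} \<subseteq> {1..N}"
  proof
    fix x assume "x \<in> q ` {1..n}"
    then obtain i where i: "i \<in> {1..n}" "x = q i" by auto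
    then have "lam (n + 1 - i) \<le> lam 1" by (intro lam) auto
    with i N show "x \<in> {1..N}" by (simp add: q_def)
  qed
  \<comment> \<open>The values left over, to be enumerated increasingly by \<open>h\<close>.\<close>
  define M where "M = {1..N} - q ` {1..n}"
  have "card (q ` {1..n}) = n"
    using card_image[OF strict_mono_on_imp_inj_on[OF q_mono]] by simp
  then have cardM: "card M = N - n"
    unfolding M_def using q_range by (simp add: card_Diff_subset)
  obtain h where h: "bij_betw h {..<card M} M" "strict_mono_on {..<card M} h"
    using ex_bij_betw_strict_mono_card[of M] by (auto simp: M_def)
  define s where "s i = (if i \<in> {1..n} then q i else if i \<in> {n<..N} then h (i - Suc n) else i)" for i
  have "bij_betw s ({1..n} \<union> {n<..N}) (q ` {1..n} \<union> M)"
  proof (rule bij_betw_combine)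
    have "bij_betw q {1..n} (q ` {1..n})"
      by (rule bij_betw_imageI[OF strict_mono_on_imp_inj_on[OF q_mono] refl])
    then show "bij_betw s {1..n} (q ` {1..n})"
      by (rule bij_betw_cong[THEN iffD1, rotated]) (simp add: s_def)
    have "bij_betw (\<lambda>i. i - Suc n) {n<..N} {..<card M}"
      by (rule bij_betw_byWitness[where f' = "\<lambda>i. i + Suc n"]) (auto simp: cardM)
    then have "bij_betw (h \<circ> (\<lambda>i. i - Suc n)) {n<..N} M"
      using h(1) by (rule bij_betw_trans)
    then show "bij_betw s {n<..N} M"
      by (rule bij_betw_cong[THEN iffD1, rotated]) (simp add: s_def)
  qed (auto simp: M_def)
  moreover have "{1..n} \<union> {n<..N} = {1..N}" "q ` {1..n} \<union> M = {1..N}"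
    using N q_range by (auto simp: M_def)
  ultimately have "s permutes {1..N}"
    using n by (intro bij_imp_permutes) (auto simp: s_def)
  moreover have "strict_mono_on {n<..} s"
  proof (rule strict_mono_onI)
    fix i j assume ij: "i \<in> {n<..}" "j \<in> {n<..}" "i < j"
    show "s i < s j"
    proof (cases "j \<le> N")
      case True
      then have "h (i - Suc n) < h (j - Suc n)"
        using ij by (intro strict_mono_onD[OF h(2)]) (auto simp: cardM)
      with True ij show ?thesis by (simp add: s_def)
    next
      case False
      have "s i \<le> max N i"
        using \<open>s permutes {1..N}\<close> permutes_in_image[of s "{1..N}" i] permutes_not_in[of s "{1..N}" i]
        by (cases "i \<in> {1..N}") auto
      moreover have "s j = j"
        using False ij by (simp add: s_def)
      ultimately show ?thesis using False ij by simp
    qed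
  qed
  ultimately have Ps: "?P s"
    by (simp add: s_def q_def)
  have unique: "t = s" if t: "?P t" for t
  proof (rule strict_mono_perms_agree)
    show "t i = s i" if "i \<le> n" for i
      using that t Ps permutes_not_in[of t "{1..N}" 0] permutes_not_in[of s "{1..N}" 0] by (cases i) auto
  qed (use t Ps in \<open>auto intro: permutes_bij\<close>)
  have "?P (grassmannian_perm N n lam)"
    unfolding grassmannian_perm_def using Ps unique by (rule theI)
  then show "\<And>i. i \<in> {1..n} \<Longrightarrow> grassmannian_perm N n lam i = i + lam (n + 1 - i)"
    and "grassmannian N n (grassmannian_perm N n lam)"
    using q_mono by (auto simp: grassmannian_def q_def strict_mono_on_def)
qed

lemma one_plus_bet_xv_nonzero: "1 + bet * xv i \<noteq> 0"
proof
  assume "1 + bet * xv i = 0"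
  then have "Poly_Mapping.lookup (1 + bet * xv i) 0 = 0" by simp
  moreover have "Poly_Mapping.single (XVar i) (1 :: nat) \<noteq> 0"
    by (metis lookup_single_eq lookup_zero one_neq_zero)
  then have "Poly_Mapping.lookup (bet * xv i) 0 = 0"
    by (simp add: bet_def xv_def mult_single lookup_single when_def)
  ultimately show False
    by (simp add: lookup_add)
qed

lemma vprod_xv_nonzero: "vprod n xv m \<noteq> 0"
proof -
  have fin: "finite {(i, j). m \<le> i \<and> i < j \<and> j \<le> n}"
    by (rule finite_subset[of _ "{..n} \<times> {..n}"]) auto
  have "xv i \<noteq> xv j" if "i < j" for i j
  proof
    assume "xv i = xv j"
    then have "Poly_Mapping.keys (xv i) = Poly_Mapping.keys (xv j)" by simp
    then have "Poly_Mapping.keys (Poly_Mapping.single (XVar i) (1::nat))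
        = Poly_Mapping.keys (Poly_Mapping.single (XVar j) (1::nat))"
      by (simp add: xv_def)
    then show False using that by simp
  qed
  then show ?thesis
    using fin by (force simp: prod_zero_iff)
qed

lemma to_fract_eq_divide:
  fixes a d v :: "'a::idom"
  assumes "v * a = d" "v \<noteq> 0"
  shows "to_fract a = to_fract d / to_fract v"
proof -
  have "to_fract a * to_fract v = to_fract d"
    using assms(1) by (simp add: mult.commute flip: to_fract_mult)
  then show ?thesis
    using assms(2) by (simp add: nonzero_eq_divide_eq)
qed

theorem theorem1p4:
  fixes n N :: nat and lam :: "nat \<Rightarrow> nat"
  assumes "n \<ge> 1"
    and "\<And>i j. 1 \<le> i \<Longrightarrow> i \<le> j \<Longrightarrow> j \<le> n \<Longrightarrow> lam j \<le> lam i"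
    and "N \<ge> n + lam 1"
  shows
    "groth N (grassmannian_perm N n lam)
       = det (mat n n (\<lambda>(i, j). hbeta n (int (lam (j + 1)) + int (i + 1)) (j + 1)))
     \<and> to_fract (groth N (grassmannian_perm N n lam))
       = to_fract (det (mat n n (\<lambda>(i, j).
             xv (i + 1) ^ (lam (j + 1) + n - (j + 1)) * (1 + bet * xv (i + 1)) ^ j)))
         / to_fract (\<Prod>(i, j) \<in> {(i, j). 1 \<le> i \<and> i < j \<and> j \<le> n}. xv i - xv j)
     \<and> to_fract (double_groth N (grassmannian_perm N n lam))
       = to_fract (det (mat n n (\<lambda>(i, j).
             (\<Prod>a = 1..lam (j + 1) + n - (j + 1).
                 xv (i + 1) + yv a + bet * xv (i + 1) * yv a) * (1 + bet * xv (i + 1)) ^ j)))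
         / to_fract (\<Prod>(i, j) \<in> {(i, j). 1 \<le> i \<and> i < j \<and> j \<le> n}. xv i - xv j)"
proof -
  let ?s = "grassmannian_perm N n lam"
  have props: "grassmannian N n ?s" "\<And>i. i \<in> {1..n} \<Longrightarrow> ?s i = i + lam (n + 1 - i)"
    using grassmannian_perm_properties[of n lam N] assms by blast+
  have perm: "?s permutes {1..N}"
    using props(1) by (simp add: grassmannian_def)
  have exponent: "?s (n - j) - Suc 0 = lam (Suc j) + n - Suc j" if "j < n" for j
    using props(2)[of "n - j"] that by simp
  have "n \<le> N" using assms(3) by simp
  note transfer = grassmannian_transfer[OF one_plus_bet_xv_nonzero \<open>n \<le> N\<close> props(1)]
  have det: "row_det n xv Y 1 ?s = det (mat n n (\<lambda>(i, j).
      (\<Prod>a = 1..lam (j + 1) + n - (j + 1). xv (i + 1) + Y a + bet * xv (i + 1) * Y a)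
      * (1 + bet * xv (i + 1)) ^ j))" for Y
    unfolding row_det_def fpow_def fgl_def
    by (intro arg_cong[of _ _ det] eq_matI) (simp_all add: exponent)
  have double: "vprod n xv 1 * double_groth N ?s = det (mat n n (\<lambda>(i, j).
      (\<Prod>a = 1..lam (j + 1) + n - (j + 1). xv (i + 1) + yv a + bet * xv (i + 1) * yv a)
      * (1 + bet * xv (i + 1)) ^ j))"
    unfolding double_groth_eq_rowops[OF perm] transfer det ..
  have single: "vprod n xv 1 * groth N ?s = det (mat n n (\<lambda>(i, j).
      xv (i + 1) ^ (lam (j + 1) + n - (j + 1)) * (1 + bet * xv (i + 1)) ^ j))"
    unfolding groth_eq_rowops[OF perm] transfer det by simp
  have "vprod n xv 1 * groth N ?s
      = vprod n xv 1 * det (mat n n (\<lambda>(i, j). hbeta n (int (lam (j + 1)) + int (i + 1)) (j + 1)))"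
    unfolding single jacobi_trudi_hbeta ..
  then have "groth N ?s = det (mat n n (\<lambda>(i, j). hbeta n (int (lam (j + 1)) + int (i + 1)) (j + 1)))"
    by (simp only: mult_left_cancel[OF vprod_xv_nonzero])
  then show ?thesis
    by (intro conjI to_fract_eq_divide[OF single vprod_xv_nonzero]
        to_fract_eq_divide[OF double vprod_xv_nonzero])
qed

end
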